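(* Let $p$ be a probability density on $\mathbb{R}^d$ such that (i) $p$ is log-concave and $p(x)>0$ for all $x\in\mathbb{R}^d$, and (ii) $p$ is three times differentiable and $M:=\sup_{x\in\mathbb{R}^d}\|\nabla^3 \ln p(x)\|_F<\infty$. Let $\tau>0$ and $y\in\mathbb{R}^d$, and let $x^\star:=\mathrm{prox}_{-\tau\ln p}(y)$. Define the iterates $x_0=y$ and, for $k\ge 0$, $$x_{k+1}=\alpha_k\,\mathrm{MMSE}_{\sigma_k}(x_k)+(1-\alpha_k)\,y,\qquad \alpha_k=\frac{k+1}{k+2},\quad \sigma_k^2=\frac{\tau}{k+1}.$$ Then for all $k\ge 1$, $$\|x_k-x^\star\|\le \frac{\ln k+7}{k+1}\Big[\|y-x^\star\|+\tau^2 M\sqrt{d}\Big].$$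
   Context: For $\sigma>0$, $p_\sigma$ denotes the density of $X+\sigma\varepsilon$ where $X\sim p$ and $\varepsilon\sim\mathcal N(0,I_d)$ are independent (the convolution of $p$ with a centred Gaussian of covariance $\sigma^2 I_d$). The MMSE denoiser is $\mathrm{MMSE}_\sigma(z):=\mathbb{E}[X\mid X+\sigma\varepsilon=z]$. For a tensor $A\in\mathbb{R}^{d\times d\times d}$, $\|A\|_F=(\sum_{i,j,k}A_{ijk}^2)^{1/2}$. The proximal point is $\mathrm{prox}_{-\tau\ln p}(y):=\arg\min_{x\in\mathbb{R}^d}\big\{\tfrac12\|y-x\|^2-\tau\ln p(x)\big\}$, which is unique since this objective is $1$-strongly convex. *)

theory Defs
  imports "HOL-Analysis.Analysis"
begin

definition gauss_dens :: "real \<Rightarrow> 'a::euclidean_space \<Rightarrow> real" where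
  "gauss_dens \<sigma> u = (2 * pi * \<sigma>\<^sup>2) powr (- real DIM('a) / 2) * exp (- (norm u)\<^sup>2 / (2 * \<sigma>\<^sup>2))"

definition smoothed_density :: "('a::euclidean_space \<Rightarrow> real) \<Rightarrow> real \<Rightarrow> 'a \<Rightarrow> real" where
  "smoothed_density p \<sigma> z = (\<integral>x. p x * gauss_dens \<sigma> (z - x) \<partial>lborel)"

text \<open>MMSE denoiser E[X | X + sigma eps = z] (posterior mean, joint density p(x) gauss_dens sigma (z - x)).\<close>
definition mmse :: "('a::euclidean_space \<Rightarrow> real) \<Rightarrow> real \<Rightarrow> 'a \<Rightarrow> 'a" where
  "mmse p \<sigma> z = (\<integral>x. (p x * gauss_dens \<sigma> (z - x)) *\<^sub>R x \<partial>lborel) /\<^sub>R smoothed_density p \<sigma> z"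

definition prox_neg_log :: "('a::euclidean_space \<Rightarrow> real) \<Rightarrow> real \<Rightarrow> 'a \<Rightarrow> 'a" where
  "prox_neg_log p \<tau> y = arg_min (\<lambda>x. (1/2) * (norm (y - x))\<^sup>2 - \<tau> * ln (p x)) (\<lambda>_. True)"

primrec prox_iter :: "('a::euclidean_space \<Rightarrow> real) \<Rightarrow> real \<Rightarrow> 'a \<Rightarrow> nat \<Rightarrow> 'a" where
  "prox_iter p \<tau> y 0 = y"
| "prox_iter p \<tau> y (Suc k) =
     (let \<alpha> = (real k + 1) / (real k + 2); \<sigma> = sqrt (\<tau> / (real k + 1))
      in \<alpha> *\<^sub>R mmse p \<sigma> (prox_iter p \<tau> y k) + (1 - \<alpha>) *\<^sub>R y)"

definition frob3 :: "'a::euclidean_space \<Rightarrow>\<^sub>L 'a \<Rightarrow>\<^sub>L 'a \<Rightarrow>\<^sub>L real \<Rightarrow> real" where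
  "frob3 T = sqrt (\<Sum>i\<in>Basis. \<Sum>j\<in>Basis. \<Sum>k\<in>Basis. (blinfun_apply (blinfun_apply (blinfun_apply T i) j) k)\<^sup>2)"

end

theory Submission
  imports Defs "HOL-Probability.Probability_Measure"
begin

text \<open>
  Write \<open>m = mmse p \<sigma> z\<close> for the mean of the posterior \<open>\<mu> \<propto> p \<cdot> gauss_dens \<sigma> (z - \<cdot>)\<close>. Integration by parts gives
  \<open>m = z + \<sigma>\<^sup>2 E\<^sub>\<mu>[\<nabla>ln p]\<close>, so \<open>m\<close> is the proximal point of a point at distance
  \<open>\<sigma>\<^sup>2 |E\<^sub>\<mu>[\<nabla>ln p] - \<nabla>ln p(m)|\<close> from \<open>z\<close>. Taylor expansion along rays from \<open>m\<close> turns this bias into the covariances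
  of \<open>x - m\<close> with the fields \<open>x \<mapsto> \<nabla>\<^sup>2 ln p(m + t (x - m)) v\<close>. Since \<open>\<mu>\<close> is \<open>1/\<sigma>\<^sup>2\<close>-strongly log-concave, the
  Poincare inequality bounds the two variances by \<open>\<sigma>\<^sup>2 t\<^sup>2 M\<^sup>2 |v|\<^sup>2\<close> and \<open>\<sigma>\<^sup>2 d\<close>, and the bias is at most
  \<open>\<sigma>\<^sup>2 M \<surd>d\<close>. With the given \<open>\<alpha>\<^sub>k\<close> and \<open>\<sigma>\<^sub>k\<close> the errors \<open>k |m\<^sub>k\<^sub>-\<^sub>1 - x\<^sup>*|\<close> then grow by at most
  \<open>\<tau>\<^sup>2 M \<surd>d / (k + 1)\<close> per step, a harmonic sum.

  The Poincare inequality is obtained from the Prekopa--Leindler inequality applied to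
  \<open>exp (inf_conv \<kappa> (\<epsilon> g))\<close> and \<open>exp (- \<epsilon> g)\<close>, to second order in \<open>\<epsilon>\<close>.
\<close>

section \<open>The Prekopa--Leindler inequality\<close>

text \<open>As ln p is merely concave, the proximal map is nonexpansive and nothing more; there is
  no contraction factor to iterate. The decay comes from averaging with y, which multiplies the
  previous denoising error by k / (k + 1). The bias shifts the input of the proximal map by at most
  \<sigma>^4 M sqrt d, that is \<tau>^2 M sqrt d / (k + 1)^2 for the given noise level, and such
  errors still add up to order ln k / k. The delicate point is sqrt d. Bounding the Taylor remainder
  of the score pointwise by M |x - m|^2 costs a factor d, since E|x - m|^2 is only bounded by
  \<sigma>^2 d. As E(x - m) = 0, the Hessian can be centred before it is paired with x - m, and
  Cauchy--Schwarz over all coordinates at once meets the Frobenius norm once and sqrt d once.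
  Deriving the Poincare inequality from a midpoint inequality asks only measurability of the
  density, and its sole geometric input is the length of midpoint sets on the line.\<close>

lemma emeasure_initial_segment_approx:
  fixes A :: "real set"
  assumes A [measurable]: "A \<in> sets borel" and c: "c < emeasure lborel A"
  shows "\<exists>a\<in>A. c < emeasure lborel (A \<inter> {..a})"
proof (rule ccontr)
  assume *: "\<not> (\<exists>a\<in>A. c < emeasure lborel (A \<inter> {..a}))"
  have le: "emeasure lborel (A \<inter> {..r}) \<le> c" if "a \<in> A" "r \<le> a" for a r
  proof -
    have "emeasure lborel (A \<inter> {..r}) \<le> emeasure lborel (A \<inter> {..a})"
      using that by (intro emeasure_mono) auto
    then show ?thesis using * that by (auto simp: not_less intro: order_trans)
  qed
  have ne: "A \<noteq> {}" using c by auto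
  \<comment> \<open>Continuity from below, with the extra demand that every \<open>r n\<close> is at
    most some point of A, because the cut has to be made at an element of A. An attained supremum,
    one that is not attained, and an unbounded set call for different sequences.\<close>
  obtain r :: "nat \<Rightarrow> real" where r: "incseq r" "A \<subseteq> (\<Union>n. {..r n})" "\<And>n. \<exists>a\<in>A. r n \<le> a"
  proof (cases "bdd_above A")
    case True
    show ?thesis
    proof (cases "Sup A \<in> A")
      case True
      then show ?thesis
        using that[of "\<lambda>_. Sup A"] cSup_upper[OF _ \<open>bdd_above A\<close>] by (auto simp: incseq_def)
    next
      case False
      show ?thesis
      proof (rule that[of "\<lambda>n. Sup A - inverse (real (Suc n))"])
        show "incseq (\<lambda>n. Sup A - inverse (real (Suc n)))"
          by (auto simp: incseq_def intro!: le_imp_inverse_le)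
        show "\<exists>a\<in>A. Sup A - inverse (real (Suc n)) \<le> a" for n
          using less_cSup_iff[OF ne True, of "Sup A - inverse (real (Suc n))"] by (auto intro: less_imp_le)
        show "A \<subseteq> (\<Union>n. {..Sup A - inverse (real (Suc n))})"
        proof
          fix a assume a: "a \<in> A"
          have "a < Sup A" using cSup_upper[OF a True] False a by (cases "a = Sup A") auto
          then obtain n where "inverse (real (Suc n)) < Sup A - a"
            using reals_Archimedean[of "Sup A - a"] by auto
          then show "a \<in> (\<Union>n. {..Sup A - inverse (real (Suc n))})"
            by (auto intro!: exI[of _ n])
        qed
      qed
    qed
  next
    case False
    then have "\<exists>a\<in>A. real n \<le> a" for n
      by (metis bdd_above.I linorder_le_cases)
    then show ?thesis using that[of real] real_arch_simple by (force simp: incseq_def)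
  qed
  have "emeasure lborel A = emeasure lborel (\<Union>n. A \<inter> {..r n})"
    using r(2) by (intro arg_cong[where f="emeasure lborel"]) auto
  also have "\<dots> = (SUP n. emeasure lborel (A \<inter> {..r n}))"
    using r(1) by (intro SUP_emeasure_incseq[symmetric]) (auto simp: incseq_def, meson order_trans)
  also have "\<dots> \<le> c"
    using r(3) le by (intro SUP_least) blast
  finally show False using c by simp
qed

lemma emeasure_reflect_real:
  fixes B :: "real set"
  assumes [measurable]: "B \<in> sets borel"
  shows "emeasure lborel (uminus -` B) = emeasure lborel B"
proof -
  have "emeasure lborel B = emeasure (distr lborel borel uminus) B" by (simp add: lborel_distr_uminus)
  also have "\<dots> = emeasure lborel (uminus -` B)" by (subst emeasure_distr) auto
  finally show ?thesis by simp
qed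

lemma emeasure_final_segment_approx:
  fixes B :: "real set"
  assumes B [measurable]: "B \<in> sets borel" and c: "c < emeasure lborel B"
  shows "\<exists>b\<in>B. c < emeasure lborel (B \<inter> {b..})"
proof -
  have m: "uminus -` B \<in> sets borel"
    by (rule measurable_sets_borel[OF _ B]) auto
  obtain b where b: "-b \<in> B" "c < emeasure lborel (uminus -` B \<inter> {..b})"
    using emeasure_initial_segment_approx[OF m, of c] c by (auto simp: emeasure_reflect_real)
  have "uminus -` B \<inter> {..b} = uminus -` (B \<inter> {-b..})" by auto
  then have "c < emeasure lborel (B \<inter> {-b..})"
    using b(2) emeasure_reflect_real[of "B \<inter> {-b..}"] by simp
  then show ?thesis using b(1) by blast
qed

text \<open>The preimage is the set of midpoints of A with the single point t, which is how scaled
  copies of two sets are placed inside their midpoint set.\<close>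

lemma emeasure_half_affine:
  fixes A :: "real set"
  assumes A [measurable]: "A \<in> sets borel"
  shows "emeasure lborel A = 2 * emeasure lborel ((\<lambda>s. 2 * s - t) -` A)"
proof -
  have m [measurable]: "(\<lambda>s. 2 * s - t) -` A \<in> sets borel"
    by (rule measurable_sets_borel[OF _ A]) auto
  have "emeasure lborel A = (\<integral>\<^sup>+x. indicator A x \<partial>lborel)" by simp
  also have "\<dots> = 2 * (\<integral>\<^sup>+x. indicator A (- t + 2 * x) \<partial>lborel)"
    by (subst nn_integral_real_affine[where c=2 and t="-t"]) auto
  also have "(\<integral>\<^sup>+x. indicator A (- t + 2 * x) \<partial>lborel) = (\<integral>\<^sup>+x. indicator ((\<lambda>s. 2 * s - t) -` A) x \<partial>lborel)"
    by (intro nn_integral_cong) (auto simp: indicator_def algebra_simps)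
  also have "\<dots> = emeasure lborel ((\<lambda>s. 2 * s - t) -` A)" by simp
  finally show ?thesis .
qed

text \<open>After cutting at \<open>a \<in> A\<close> and \<open>b \<in> B\<close>, the sets
  \<open>(A \<inter> {..a} + b) / 2\<close> and \<open>(a + B \<inter> {b..}) / 2\<close> meet only in \<open>(a + b) / 2\<close>.\<close>

lemma brunn_minkowski_real:
  fixes A B C :: "real set"
  assumes [measurable]: "A \<in> sets borel" "B \<in> sets borel" "C \<in> sets borel"
    and ne: "A \<noteq> {}" "B \<noteq> {}"
    and mid: "\<And>a b. a \<in> A \<Longrightarrow> b \<in> B \<Longrightarrow> (a + b) / 2 \<in> C"
  shows "emeasure lborel A + emeasure lborel B \<le> 2 * emeasure lborel C"
proof -
  have cut: "emeasure lborel (A \<inter> {..a}) + emeasure lborel (B \<inter> {b..}) \<le> 2 * emeasure lborel C"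
    if "a \<in> A" "b \<in> B" for a b
  proof -
    let ?A = "(\<lambda>s. 2 * s - b) -` (A \<inter> {..a})" and ?B = "(\<lambda>s. 2 * s - a) -` (B \<inter> {b..})"
    have m [measurable]: "?A \<in> sets borel" "?B \<in> sets borel"
      by (rule measurable_sets_borel[of _ borel]; measurable)+
    have "emeasure lborel (A \<inter> {..a}) + emeasure lborel (B \<inter> {b..})
        = 2 * (emeasure lborel ?A + emeasure lborel ?B)"
      by (simp add: emeasure_half_affine[of "A \<inter> {..a}" b] emeasure_half_affine[of "B \<inter> {b..}" a] distrib_left)
    also have "emeasure lborel ?A + emeasure lborel ?B
        = emeasure lborel ?A + emeasure lborel (?B - {(a + b) / 2})"
      by (subst emeasure_Diff_null_set) (auto simp: null_sets_def)
    also have "\<dots> = emeasure lborel (?A \<union> (?B - {(a + b) / 2}))"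
      by (intro plus_emeasure) (auto simp: field_simps)
    also have "\<dots> \<le> emeasure lborel C"
    proof (intro emeasure_mono subsetI)
      fix s assume "s \<in> ?A \<union> (?B - {(a + b) / 2})"
      then show "s \<in> C"
        using mid[of "2 * s - b" b] mid[of a "2 * s - a"] that by auto
    qed auto
    finally show ?thesis by (simp add: mult_left_mono)
  qed
  have supA: "emeasure lborel A \<le> (SUP a\<in>A. emeasure lborel (A \<inter> {..a}))"
    using emeasure_initial_segment_approx[of A] by (auto simp: le_SUP_iff)
  have supB: "emeasure lborel B \<le> (SUP b\<in>B. emeasure lborel (B \<inter> {b..}))"
    using emeasure_final_segment_approx[of B] by (auto simp: le_SUP_iff)
  have bA: "emeasure lborel A + emeasure lborel (B \<inter> {b..}) \<le> 2 * emeasure lborel C" if "b \<in> B" for b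
  proof -
    have "emeasure lborel A + emeasure lborel (B \<inter> {b..})
        \<le> (SUP a\<in>A. emeasure lborel (A \<inter> {..a})) + emeasure lborel (B \<inter> {b..})"
      using supA by (rule add_right_mono)
    also have "\<dots> = (SUP a\<in>A. emeasure lborel (A \<inter> {..a}) + emeasure lborel (B \<inter> {b..}))"
      using ne by (simp add: ennreal_SUP_add_left)
    also have "\<dots> \<le> 2 * emeasure lborel C"
      using cut that by (intro SUP_least) auto
    finally show ?thesis .
  qed
  have "emeasure lborel A + emeasure lborel B
      \<le> emeasure lborel A + (SUP b\<in>B. emeasure lborel (B \<inter> {b..}))"
    using supB by (rule add_left_mono)
  also have "\<dots> = (SUP b\<in>B. emeasure lborel A + emeasure lborel (B \<inter> {b..}))"
    using ne by (simp add: ennreal_SUP_add_right)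
  also have "\<dots> \<le> 2 * emeasure lborel C"
    using bA by (intro SUP_least) auto
  finally show ?thesis .
qed

section \<open>Prekopa--Leindler on the line\<close>

text \<open>A value c is the length of the set of levels t > 0 below it, and Tonelli exchanges the
  integrals. The indicator of positive t is there because \<open>ennreal\<close> sends negative t to
  0, so negative levels would be counted as well.\<close>

lemma nn_integral_layer_cake:
  fixes u :: "real \<Rightarrow> ennreal"
  assumes [measurable]: "u \<in> borel_measurable borel"
  shows "(\<integral>\<^sup>+x. u x \<partial>lborel) = (\<integral>\<^sup>+t. indicator {0<..} t * emeasure lborel {x. ennreal t < u x} \<partial>lborel)"
proof -
  have layer: "(\<integral>\<^sup>+t. indicator {0<..} t * indicator {t. ennreal t < c} t \<partial>lborel) = c" for c :: ennreal
  proof (cases c)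
    case (real r)
    have "(\<integral>\<^sup>+t. indicator {0<..} t * indicator {t. ennreal t < c} t \<partial>lborel)
        = (\<integral>\<^sup>+t. indicator {0<..<r} t \<partial>lborel)"
      using real by (intro nn_integral_cong) (auto simp: indicator_def ennreal_less_iff)
    then show ?thesis using real by simp
  next
    case top
    have "ennreal (real n) \<le> emeasure lborel {0::real<..}" for n
      using emeasure_mono[of "{0<..<real n}" "{0<..}" lborel] by (simp add: subset_iff)
    then have "emeasure lborel {0::real<..} = top"
      using SUP_least[of UNIV of_nat "emeasure lborel {0::real<..}"]
      by (simp add: ennreal_SUP_of_nat_eq_top top_unique flip: ennreal_of_nat_eq_real_of_nat)
    moreover have "(\<integral>\<^sup>+t. indicator {0<..} t * indicator {t. ennreal t < c} t \<partial>lborel)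
        = (\<integral>\<^sup>+t. indicator {0::real<..} t \<partial>lborel)"
      using top by (intro nn_integral_cong) (auto simp: indicator_def)
    ultimately show ?thesis using top by simp
  qed
  have "(\<integral>\<^sup>+x. u x \<partial>lborel)
      = (\<integral>\<^sup>+x. (\<integral>\<^sup>+t. indicator {0<..} t * indicator {t. ennreal t < u x} t \<partial>lborel) \<partial>lborel)"
    by (simp add: layer)
  also have "\<dots> = (\<integral>\<^sup>+t. (\<integral>\<^sup>+x. indicator {0<..} t * indicator {x. ennreal t < u x} x \<partial>lborel) \<partial>lborel)"
    by (subst lborel_pair.Fubini') (auto simp: indicator_def)
  also have "\<dots> = (\<integral>\<^sup>+t. indicator {0<..} t * emeasure lborel {x. ennreal t < u x} \<partial>lborel)"
    by (intro nn_integral_cong) (simp add: nn_integral_cmult)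
  finally show ?thesis .
qed

text \<open>Arithmetic-geometric mean, free of roots so that infinite values are covered. It turns
  the additive bound on the line into the product form, which survives rescaling and
  tensorisation.\<close>

lemma ennreal_arith_geo_mean:
  fixes a b c :: ennreal
  assumes "a + b \<le> 2 * c"
  shows "a * b \<le> c\<^sup>2"
proof (cases "c = top")
  case False
  then have "2 * c \<noteq> top" by (simp add: ennreal_mult_eq_top_iff)
  then have fin: "a \<noteq> top" "b \<noteq> top" using assms by (auto simp: top_unique)
  obtain x y z where r: "a = ennreal x" "b = ennreal y" "c = ennreal z" "0 \<le> x" "0 \<le> y" "0 \<le> z"
    using False fin by (metis ennreal_cases)
  have "ennreal (x + y) \<le> ennreal (2 * z)"
    using assms r by (simp add: ennreal_mult')
  then have "x + y \<le> 2 * z" using r by (simp only: ennreal_le_iff mult_nonneg_nonneg zero_le_numeral)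
  then have "(x + y)\<^sup>2 \<le> (2 * z)\<^sup>2" using r by (intro power_mono) auto
  then have "x * y \<le> z\<^sup>2"
    using zero_le_power2[of "x - y"] by (simp add: power2_eq_square algebra_simps)
  then show ?thesis using r by (simp add: ennreal_power ennreal_leI flip: ennreal_mult')
qed (simp add: power2_eq_square)

text \<open>Equal suprema make the levels comparable: for 0 < t < 1 both superlevel sets are
  nonempty, so Brunn--Minkowski applies to them, and for t \<ge> 1 both are empty. Integration over
  t concludes.\<close>

lemma prekopa_leindler_real_normalised:
  fixes u v w :: "real \<Rightarrow> ennreal"
  assumes [measurable]: "u \<in> borel_measurable borel" "v \<in> borel_measurable borel" "w \<in> borel_measurable borel"
    and sup: "(SUP x. u x) = 1" "(SUP x. v x) = 1"
    and mid: "\<And>x y. u x * v y \<le> (w ((x + y) / 2))\<^sup>2"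
  shows "(\<integral>\<^sup>+x. u x \<partial>lborel) + (\<integral>\<^sup>+x. v x \<partial>lborel) \<le> 2 * (\<integral>\<^sup>+x. w x \<partial>lborel)"
proof -
  have level: "emeasure lborel {x. ennreal t < u x} + emeasure lborel {x. ennreal t < v x}
      \<le> 2 * emeasure lborel {x. ennreal t < w x}" if t: "0 < t" for t
  proof (cases "t < 1")
    case True
    then have t1: "ennreal t < 1" using t by (simp add: ennreal_less_one_iff)
    show ?thesis
    proof (rule brunn_minkowski_real)
      show "{x. ennreal t < u x} \<noteq> {}" "{x. ennreal t < v x} \<noteq> {}"
        using t1 less_SUP_iff[of "ennreal t" u UNIV] less_SUP_iff[of "ennreal t" v UNIV] sup by auto
      show "(a + b) / 2 \<in> {x. ennreal t < w x}"
        if ab: "a \<in> {x. ennreal t < u x}" "b \<in> {x. ennreal t < v x}" for a b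
      proof -
        obtain s where s: "ennreal t < s" "s < min (u a) (v b)"
          using dense[of "ennreal t" "min (u a) (v b)"] ab by auto
        have "s\<^sup>2 \<le> u a * v b"
          using s(2) unfolding power2_eq_square by (intro mult_mono) auto
        also note mid[of a b]
        finally have le: "s\<^sup>2 \<le> (w ((a + b) / 2))\<^sup>2" .
        have "ennreal t < w ((a + b) / 2)"
        proof (rule ccontr)
          assume "\<not> ?thesis"
          then have wt: "w ((a + b) / 2) \<le> ennreal t" by simp
          then have "w ((a + b) / 2) < top" by (auto intro: le_less_trans)
          moreover have "s < top" using s(2) by (auto intro: less_le_trans)
          ultimately obtain r s' where r: "w ((a + b) / 2) = ennreal r" "0 \<le> r" "s = ennreal s'" "0 \<le> s'"
            by (metis ennreal_cases less_irrefl)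
          then have "r \<le> t" "t < s'" "s'\<^sup>2 \<le> r\<^sup>2"
            using wt s(1) le t by (auto simp: ennreal_power ennreal_le_iff ennreal_less_iff)
          then show False using r(2,4) by (smt (verit) power2_le_imp_le)
        qed
        then show ?thesis by simp
      qed
    qed auto
  next
    case False
    then have "1 \<le> ennreal t" using t by simp
    moreover have "u x \<le> 1" "v x \<le> 1" for x using sup by (metis SUP_upper UNIV_I)+
    ultimately have "u x \<le> ennreal t" "v x \<le> ennreal t" for x by (blast intro: order_trans)+
    then have "{x. ennreal t < u x} = {}" "{x. ennreal t < v x} = {}" by (simp_all add: not_less)
    then show ?thesis by simp
  qed
  have "(\<integral>\<^sup>+x. u x \<partial>lborel) + (\<integral>\<^sup>+x. v x \<partial>lborel)
      = (\<integral>\<^sup>+t. indicator {0<..} t * emeasure lborel {x. ennreal t < u x}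
          + indicator {0<..} t * emeasure lborel {x. ennreal t < v x} \<partial>lborel)"
    unfolding nn_integral_layer_cake[OF assms(1)] nn_integral_layer_cake[OF assms(2)]
    by (rule nn_integral_add[symmetric]) measurable
  also have "\<dots> \<le> (\<integral>\<^sup>+t. 2 * (indicator {0<..} t * emeasure lborel {x. ennreal t < w x}) \<partial>lborel)"
    using level by (intro nn_integral_mono) (auto simp: indicator_def)
  also have "\<dots> = 2 * (\<integral>\<^sup>+x. w x \<partial>lborel)"
    unfolding nn_integral_layer_cake[OF assms(3)] by (rule nn_integral_cmult) measurable
  finally show ?thesis .
qed

lemma prekopa_leindler_real_bounded:
  fixes u v w :: "real \<Rightarrow> ennreal"
  assumes [measurable]: "u \<in> borel_measurable borel" "v \<in> borel_measurable borel" "w \<in> borel_measurable borel"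
    and bdd: "\<And>x. u x \<le> ennreal K" "\<And>x. v x \<le> ennreal K"
    and mid: "\<And>x y. u x * v y \<le> (w ((x + y) / 2))\<^sup>2"
  shows "(\<integral>\<^sup>+x. u x \<partial>lborel) * (\<integral>\<^sup>+x. v x \<partial>lborel) \<le> (\<integral>\<^sup>+x. w x \<partial>lborel)\<^sup>2"
proof (cases "(SUP x. u x) = 0 \<or> (SUP x. v x) = 0")
  case True
  then have "(\<forall>x. u x = 0) \<or> (\<forall>x. v x = 0)" by (auto simp: SUP_eq_iff bot_ennreal[symmetric] SUP_bot_conv)
  then show ?thesis by auto
next
  case False
  have "(SUP x. u x) \<le> ennreal K" "(SUP x. v x) \<le> ennreal K" using bdd by (auto intro: SUP_least)
  then have "(SUP x. u x) < top" "(SUP x. v x) < top" by (auto intro: le_less_trans)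
  then obtain a b where ab: "(SUP x. u x) = ennreal a" "0 < a" "(SUP x. v x) = ennreal b" "0 < b"
    using False by (metis ennreal_0 ennreal_cases less_irrefl order_le_less top.not_eq_extremum)
  \<comment> \<open>C is the geometric mean of A and B, so scaling w by C preserves the midpoint
    hypothesis; since C^2 = A B, the factors cancel once the product form is reached.\<close>
  define A B C where "A = ennreal (1 / a)" and "B = ennreal (1 / b)" and "C = ennreal (1 / sqrt (a * b))"
  have [simp]: "A * ennreal a = 1" "B * ennreal b = 1"
    using ab by (simp_all add: A_def B_def flip: ennreal_mult')
  have C2: "C\<^sup>2 = A * B"
    using ab by (simp add: A_def B_def C_def ennreal_power power_divide flip: ennreal_mult')
  have "(\<integral>\<^sup>+x. A * u x \<partial>lborel) + (\<integral>\<^sup>+x. B * v x \<partial>lborel) \<le> 2 * (\<integral>\<^sup>+x. C * w x \<partial>lborel)"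
  proof (rule prekopa_leindler_real_normalised)
    show "(SUP x. A * u x) = 1" "(SUP x. B * v x) = 1"
      by (simp_all add: ab flip: SUP_mult_left_ennreal)
    show "A * u x * (B * v y) \<le> (C * w ((x + y) / 2))\<^sup>2" for x y
    proof -
      have "A * u x * (B * v y) = A * B * (u x * v y)" by (simp add: ac_simps)
      also have "\<dots> \<le> A * B * (w ((x + y) / 2))\<^sup>2" using mid by (intro mult_left_mono) auto
      finally show ?thesis by (simp add: power_mult_distrib C2)
    qed
  qed auto
  then have "(\<integral>\<^sup>+x. A * u x \<partial>lborel) * (\<integral>\<^sup>+x. B * v x \<partial>lborel) \<le> (\<integral>\<^sup>+x. C * w x \<partial>lborel)\<^sup>2"
    by (rule ennreal_arith_geo_mean)
  then have le: "A * B * ((\<integral>\<^sup>+x. u x \<partial>lborel) * (\<integral>\<^sup>+x. v x \<partial>lborel)) \<le> A * B * (\<integral>\<^sup>+x. w x \<partial>lborel)\<^sup>2"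
    by (simp add: nn_integral_cmult power_mult_distrib C2 ac_simps)
  have "ennreal a * ennreal b * (A * B * c) = c" for c
  proof -
    have "ennreal a * ennreal b * (A * B * c) = (A * ennreal a) * (B * ennreal b) * c" by (simp only: ac_simps)
    then show ?thesis by simp
  qed
  then show ?thesis using mult_left_mono[OF le, of "ennreal a * ennreal b"] by simp
qed

text \<open>Truncating u and v only lowers the left side of the midpoint hypothesis, so w stays
  untouched; monotone convergence then removes the truncation.\<close>

lemma prekopa_leindler_real:
  fixes u v w :: "real \<Rightarrow> ennreal"
  assumes [measurable]: "u \<in> borel_measurable borel" "v \<in> borel_measurable borel" "w \<in> borel_measurable borel"
    and mid: "\<And>x y. u x * v y \<le> (w ((x + y) / 2))\<^sup>2"
  shows "(\<integral>\<^sup>+x. u x \<partial>lborel) * (\<integral>\<^sup>+x. v x \<partial>lborel) \<le> (\<integral>\<^sup>+x. w x \<partial>lborel)\<^sup>2"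
proof -
  have SUP_min: "(SUP n. min c (of_nat n)) = c" for c :: ennreal
  proof -
    have "(SUP n. min c (of_nat n)) = min c (SUP n. of_nat n)" unfolding inf_min[symmetric] by (rule inf_SUP[symmetric])
    then show ?thesis by (simp add: ennreal_SUP_of_nat_eq_top min_absorb1)
  qed
  have mono: "incseq (\<lambda>n x. min (f x) (of_nat n))" for f :: "real \<Rightarrow> ennreal"
    unfolding incseq_def le_fun_def
    by (intro allI impI min.mono order.refl) (simp add: ennreal_of_nat_eq_real_of_nat)
  have trunc: "(\<integral>\<^sup>+x. f x \<partial>lborel) = (SUP n. \<integral>\<^sup>+x. min (f x) (of_nat n) \<partial>lborel)"
    if [measurable]: "f \<in> borel_measurable borel" for f :: "real \<Rightarrow> ennreal"
    by (subst nn_integral_monotone_convergence_SUP[symmetric, OF mono]) (simp_all add: SUP_min)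
  have step: "(\<integral>\<^sup>+x. min (u x) (of_nat n) \<partial>lborel) * (\<integral>\<^sup>+x. min (v x) (of_nat n) \<partial>lborel)
      \<le> (\<integral>\<^sup>+x. w x \<partial>lborel)\<^sup>2" for n
  proof (rule prekopa_leindler_real_bounded[where K="real n"])
    show "min (u x) (of_nat n) * min (v y) (of_nat n) \<le> (w ((x + y) / 2))\<^sup>2" for x y
      by (rule order_trans[OF mult_mono mid]) auto
  qed (auto simp: ennreal_of_nat_eq_real_of_nat)
  have inc: "incseq (\<lambda>n. \<integral>\<^sup>+x. min (f x) (of_nat n) \<partial>lborel)" for f :: "real \<Rightarrow> ennreal"
    using mono[of f] by (auto simp: incseq_def le_fun_def intro!: nn_integral_mono)
  let ?u = "\<lambda>n. \<integral>\<^sup>+x. min (u x) (of_nat n) \<partial>lborel" and ?v = "\<lambda>n. \<integral>\<^sup>+x. min (v x) (of_nat n) \<partial>lborel"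
  have "?u m * ?v n \<le> (\<integral>\<^sup>+x. w x \<partial>lborel)\<^sup>2" for m n
  proof -
    have "?u m * ?v n \<le> ?u (max m n) * ?v (max m n)"
      using incseqD[OF inc] by (intro mult_mono) auto
    also note step
    finally show ?thesis .
  qed
  then have "(SUP m. ?u m) * (SUP n. ?v n) \<le> (\<integral>\<^sup>+x. w x \<partial>lborel)\<^sup>2"
    by (auto simp: SUP_mult_left_ennreal SUP_mult_right_ennreal intro!: SUP_least)
  then show ?thesis by (simp add: trunc[of u] trunc[of v])
qed

section \<open>Tensorisation to Euclidean space\<close>

text \<open>For fixed x and y, the theorem on the line applied to the new coordinate is the midpoint
  hypothesis for the partial integrals in the remaining ones. Arguments are
  \<open>extensional\<close> because slices are known to be measurable only at points of the product
  space.\<close>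

lemma prekopa_leindler_PiM:
  fixes u v w :: "('i \<Rightarrow> real) \<Rightarrow> ennreal"
  assumes "finite I"
    and "u \<in> borel_measurable (\<Pi>\<^sub>M i\<in>I. lborel)" "v \<in> borel_measurable (\<Pi>\<^sub>M i\<in>I. lborel)"
      "w \<in> borel_measurable (\<Pi>\<^sub>M i\<in>I. lborel)"
    and "\<And>x y. x \<in> extensional I \<Longrightarrow> y \<in> extensional I \<Longrightarrow>
      u x * v y \<le> (w (\<lambda>i\<in>I. (x i + y i) / 2))\<^sup>2"
  shows "(\<integral>\<^sup>+x. u x \<partial>(\<Pi>\<^sub>M i\<in>I. lborel)) * (\<integral>\<^sup>+x. v x \<partial>(\<Pi>\<^sub>M i\<in>I. lborel))
    \<le> (\<integral>\<^sup>+x. w x \<partial>(\<Pi>\<^sub>M i\<in>I. lborel))\<^sup>2"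
  using assms
proof (induction I arbitrary: u v w rule: finite_induct)
  case empty
  interpret product_sigma_finite "\<lambda>_::'i. lborel :: real measure" ..
  show ?case
    using empty.prems(4)[of "\<lambda>_. undefined" "\<lambda>_. undefined"]
    by (simp add: nn_integral_empty restrict_def)
next
  case (insert i I)
  interpret product_sigma_finite "\<lambda>_::'i. lborel :: real measure" ..
  note [measurable] = insert.prems(1-3)
  let ?M = "\<Pi>\<^sub>M i\<in>I. (lborel :: real measure)"
  define slice where "slice f x = (\<integral>\<^sup>+s. f (x(i := s)) \<partial>lborel)" for f :: "('i \<Rightarrow> real) \<Rightarrow> ennreal" and x
  have iter: "(\<integral>\<^sup>+x. f x \<partial>(\<Pi>\<^sub>M i\<in>insert i I. lborel)) = (\<integral>\<^sup>+x. slice f x \<partial>?M)"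
    if "f \<in> borel_measurable (\<Pi>\<^sub>M i\<in>insert i I. lborel)" for f :: "('i \<Rightarrow> real) \<Rightarrow> ennreal"
    unfolding slice_def using insert.hyps that by (intro product_nn_integral_insert)
  have upd: "(\<lambda>s. f (x(i := s))) \<in> borel_measurable borel"
    if [measurable]: "f \<in> borel_measurable (\<Pi>\<^sub>M i\<in>insert i I. lborel)" and x: "x \<in> extensional I"
    for f :: "('i \<Rightarrow> real) \<Rightarrow> ennreal" and x
  proof -
    have "x \<in> space ?M" using x by (simp add: space_PiM PiE_def)
    then have "(\<lambda>s. x(i := s)) \<in> lborel \<rightarrow>\<^sub>M (\<Pi>\<^sub>M i\<in>insert i I. (lborel :: real measure))"
      by measurable
    from measurable_compose[OF this that(1)] show ?thesis by simp
  qed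
  have slice_meas: "slice f \<in> borel_measurable ?M"
    if [measurable]: "f \<in> borel_measurable (\<Pi>\<^sub>M i\<in>insert i I. lborel)" for f :: "('i \<Rightarrow> real) \<Rightarrow> ennreal"
    unfolding slice_def by measurable
  have "(\<integral>\<^sup>+x. slice u x \<partial>?M) * (\<integral>\<^sup>+x. slice v x \<partial>?M) \<le> (\<integral>\<^sup>+x. slice w x \<partial>?M)\<^sup>2"
  proof (rule insert.IH)
    fix x y :: "'i \<Rightarrow> real" assume xy: "x \<in> extensional I" "y \<in> extensional I"
    let ?z = "\<lambda>i\<in>I. (x i + y i) / 2"
    show "slice u x * slice v y \<le> (slice w ?z)\<^sup>2"
      unfolding slice_def
    proof (rule prekopa_leindler_real)
      show "u (x(i := s)) * v (y(i := t)) \<le> (w (?z(i := (s + t) / 2)))\<^sup>2" for s t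
      proof -
        have "(\<lambda>j\<in>insert i I. ((x(i := s)) j + (y(i := t)) j) / 2) = ?z(i := (s + t) / 2)"
          using insert.hyps by (auto simp: fun_eq_iff restrict_def)
        moreover have "x(i := s) \<in> extensional (insert i I)" "y(i := t) \<in> extensional (insert i I)"
          using xy by (auto simp: extensional_def)
        ultimately show ?thesis using insert.prems(4) by metis
      qed
    qed (auto intro!: upd simp: xy insert.prems)
  qed (auto intro!: slice_meas simp: insert.prems)
  then show ?case by (simp add: iter insert.prems)
qed

theorem prekopa_leindler:
  fixes u v w :: "'a::euclidean_space \<Rightarrow> ennreal"
  assumes [measurable]: "u \<in> borel_measurable borel" "v \<in> borel_measurable borel" "w \<in> borel_measurable borel"
    and mid: "\<And>x y. u x * v y \<le> (w ((x + y) /\<^sub>R 2))\<^sup>2"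
  shows "(\<integral>\<^sup>+x. u x \<partial>lborel) * (\<integral>\<^sup>+x. v x \<partial>lborel) \<le> (\<integral>\<^sup>+x. w x \<partial>lborel)\<^sup>2"
proof -
  let ?e = "\<lambda>f. \<Sum>b\<in>Basis. f b *\<^sub>R b :: 'a"
  have coord: "(\<integral>\<^sup>+x. f x \<partial>lborel) = (\<integral>\<^sup>+x. f (?e x) \<partial>(\<Pi>\<^sub>M b\<in>Basis. lborel))"
    if "f \<in> borel_measurable borel" for f :: "'a \<Rightarrow> ennreal"
  proof -
    have "(\<integral>\<^sup>+x. f x \<partial>lborel) = (\<integral>\<^sup>+x. f x \<partial>distr (\<Pi>\<^sub>M b\<in>Basis. lborel) borel ?e)"
      by (simp only: lborel_eq[where 'a='a, symmetric])
    also have "\<dots> = (\<integral>\<^sup>+x. f (?e x) \<partial>(\<Pi>\<^sub>M b\<in>Basis. lborel))"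
      by (rule nn_integral_distr) (use that in measurable)
    finally show ?thesis .
  qed
  show ?thesis
    unfolding coord[OF assms(1)] coord[OF assms(2)] coord[OF assms(3)]
  proof (rule prekopa_leindler_PiM)
    fix x y :: "'a \<Rightarrow> real"
    have "?e (\<lambda>b\<in>Basis. (x b + y b) / 2) = (\<Sum>b\<in>Basis. (x b *\<^sub>R b + y b *\<^sub>R b) /\<^sub>R 2)"
      by (intro sum.cong refl) (simp only: restrict_apply' scaleR_scaleR divide_inverse_commute scaleR_add_left[symmetric])
    also have "\<dots> = (?e x + ?e y) /\<^sub>R 2"
      by (simp only: sum.distrib scaleR_sum_right[symmetric])
    finally have "?e (\<lambda>b\<in>Basis. (x b + y b) / 2) = (?e x + ?e y) /\<^sub>R 2" .
    then show "u (?e x) * v (?e y) \<le> (w (?e (\<lambda>b\<in>Basis. (x b + y b) / 2)))\<^sup>2"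
      using mid[of "?e x" "?e y"] by simp
  qed (simp, measurable)
qed

text \<open>This is Maurey's property (tau). Prekopa--Leindler is applied to w exp q, w exp (-g) and
  w; the factor exp (\<kappa> / 4 |x - y|^2) of strong log-concavity pays for the amount by which q
  x may exceed g y.\<close>

lemma property_tau:
  fixes w :: "'a::euclidean_space \<Rightarrow> real" and g q :: "'a \<Rightarrow> real"
  assumes [measurable]: "w \<in> borel_measurable borel" "g \<in> borel_measurable borel" "q \<in> borel_measurable borel"
    and w: "\<And>x. 0 \<le> w x"
    and slc: "\<And>x y. w x * w y * exp (\<kappa> / 4 * (norm (x - y))\<^sup>2) \<le> (w ((x + y) /\<^sub>R 2))\<^sup>2"
    and q: "\<And>x y. q x \<le> g y + \<kappa> / 4 * (norm (x - y))\<^sup>2"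
    and prob: "prob_space (density lborel (\<lambda>x. ennreal (w x)))"
  shows "(\<integral>\<^sup>+x. exp (q x) \<partial>density lborel w) * (\<integral>\<^sup>+x. exp (- g x) \<partial>density lborel w) \<le> 1"
proof -
  have one: "(\<integral>\<^sup>+x. w x \<partial>lborel) = 1"
    using prob_space.emeasure_space_1[OF prob] by (simp add: emeasure_density)
  have "(\<integral>\<^sup>+x. w x * exp (q x) \<partial>lborel) * (\<integral>\<^sup>+x. w x * exp (- g x) \<partial>lborel) \<le> (\<integral>\<^sup>+x. w x \<partial>lborel)\<^sup>2"
  proof (rule prekopa_leindler)
    fix x y :: 'a
    have "w x * exp (q x) * (w y * exp (- g y)) = w x * w y * exp (q x - g y)"
      by (simp add: exp_diff exp_minus field_simps)
    also have "\<dots> \<le> w x * w y * exp (\<kappa> / 4 * (norm (x - y))\<^sup>2)"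
      using q[of x y] w by (intro mult_left_mono) auto
    also note slc
    finally have "w x * exp (q x) * (w y * exp (- g y)) \<le> (w ((x + y) /\<^sub>R 2))\<^sup>2" .
    then show "ennreal (w x * exp (q x)) * ennreal (w y * exp (- g y)) \<le> (ennreal (w ((x + y) /\<^sub>R 2)))\<^sup>2"
      using w by (simp add: ennreal_power ennreal_leI flip: ennreal_mult')
  qed auto
  then show ?thesis
    using w one by (simp add: nn_integral_density ennreal_mult')
qed

section \<open>Infimal convolutions\<close>

text \<open>The Moreau envelope of g for the cost \<kappa> / 4 |.|^2; for Lipschitz g and \<kappa> >
  0 it is the largest q that \<open>property_tau\<close> accepts.\<close>

definition inf_conv :: "real \<Rightarrow> ('a::real_normed_vector \<Rightarrow> real) \<Rightarrow> 'a \<Rightarrow> real" where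
  "inf_conv \<kappa> g x = (INF y. g y + \<kappa> / 4 * (norm (x - y))\<^sup>2)"

text \<open>Young's inequality, with equality at r = 2 s / \<kappa>. The quotient s^2 / \<kappa> is
  the source of the Poincare constant 1 / \<kappa>.\<close>

lemma quadratic_lower_bound:
  fixes \<kappa> r s :: real
  assumes "0 < \<kappa>"
  shows "s * r - s\<^sup>2 / \<kappa> \<le> \<kappa> / 4 * r\<^sup>2"
proof -
  have "0 \<le> \<kappa> / 4 * (r - 2 * s / \<kappa>)\<^sup>2" using assms by simp
  also have "\<dots> = \<kappa> / 4 * r\<^sup>2 - s * r + s\<^sup>2 / \<kappa>"
    using assms by (simp add: field_simps power2_eq_square)
  finally show ?thesis by simp
qed

context
  fixes g :: "'a::real_normed_vector \<Rightarrow> real" and L \<kappa> :: real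
  assumes lip: "\<And>x y. \<bar>g x - g y\<bar> \<le> L * norm (x - y)" and \<kappa>: "0 < \<kappa>"
begin

lemma inf_conv_aux: "g x - L\<^sup>2 / \<kappa> \<le> g y + \<kappa> / 4 * (norm (x - y))\<^sup>2"
  using lip[of x y] quadratic_lower_bound[OF \<kappa>, of L "norm (x - y)"] by linarith

lemma inf_conv_le: "inf_conv \<kappa> g x \<le> g y + \<kappa> / 4 * (norm (x - y))\<^sup>2"
  unfolding inf_conv_def using inf_conv_aux[of x] by (intro cINF_lower bdd_belowI2) auto

lemma inf_conv_le_self: "inf_conv \<kappa> g x \<le> g x"
  using inf_conv_le[of x x] by simp

lemma inf_conv_ge: "g x - L\<^sup>2 / \<kappa> \<le> inf_conv \<kappa> g x"
  unfolding inf_conv_def using inf_conv_aux[of x] by (intro cINF_greatest) auto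

text \<open>Translating a competitor for x' by x - x' keeps its quadratic cost and changes g by at
  most L |x - x'|. The resulting continuity settles measurability of the envelope.\<close>

lemma inf_conv_lipschitz: "inf_conv \<kappa> g x \<le> inf_conv \<kappa> g x' + L * norm (x - x')"
proof -
  have "inf_conv \<kappa> g x - L * norm (x - x') \<le> g y + \<kappa> / 4 * (norm (x' - y))\<^sup>2" for y
    using inf_conv_le[of x "y + (x - x')"] lip[of "y + (x - x')" y] by (simp add: algebra_simps)
  then have "inf_conv \<kappa> g x - L * norm (x - x') \<le> inf_conv \<kappa> g x'"
    unfolding inf_conv_def[of \<kappa> g x'] by (intro cINF_greatest) auto
  then show ?thesis by simp
qed

lemma continuous_on_inf_conv: "continuous_on UNIV (inf_conv \<kappa> g)"
proof -
  have L: "\<bar>L\<bar>-lipschitz_on UNIV (inf_conv \<kappa> g)"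
  proof (rule lipschitz_onI)
    fix x y :: 'a
    have "L * norm (x - y) \<le> \<bar>L\<bar> * norm (x - y)" by (intro mult_right_mono) auto
    then show "dist (inf_conv \<kappa> g x) (inf_conv \<kappa> g y) \<le> \<bar>L\<bar> * dist x y"
      using inf_conv_lipschitz[of x y] inf_conv_lipschitz[of y x]
      by (simp add: dist_norm norm_minus_commute)
  qed simp
  show ?thesis by (rule lipschitz_on_continuous_on[OF L])
qed

end

text \<open>The Lagrange remainder has order four and is nonnegative for either sign of s, so the
  truncation at an odd order is a global minorant.\<close>

lemma exp_ge_cubic: "1 + s + s\<^sup>2 / 2 + s ^ 3 / 6 \<le> exp (s::real)"
proof -
  obtain t where t: "exp s = (\<Sum>m<4. s ^ m / fact m) + exp t / fact 4 * s ^ 4"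
    using Maclaurin_exp_le[of s 4] by blast
  have "(\<Sum>m<4. s ^ m / fact m) = 1 + s + s\<^sup>2 / 2 + s ^ 3 / 6"
    by (simp add: eval_nat_numeral)
  moreover have "0 \<le> exp t / fact 4 * s ^ 4" by simp
  ultimately show ?thesis using t by linarith
qed

lemma linear_eq_sum_Basis:
  fixes D :: "'a::euclidean_space \<Rightarrow> real"
  assumes "linear D"
  shows "D h = (\<Sum>b\<in>Basis. (h \<bullet> b) * D b)"
  using linear_sum[OF assms, of "\<lambda>b. (h \<bullet> b) *\<^sub>R b" Basis]
  by (simp add: euclidean_representation linear_cmul[OF assms])

lemma norm_sq_eq_sum_Basis: "(norm (x :: 'a::euclidean_space))\<^sup>2 = (\<Sum>i\<in>Basis. (x \<bullet> i)\<^sup>2)"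
  unfolding power2_norm_eq_inner euclidean_inner[of x x] by (simp add: power2_eq_square)

lemma linear_le_l2_norm_Basis:
  fixes D :: "'a::euclidean_space \<Rightarrow> real"
  assumes "linear D"
  shows "\<bar>D h\<bar> \<le> sqrt (\<Sum>b\<in>Basis. (D b)\<^sup>2) * norm h"
proof -
  have "D h = (\<Sum>b\<in>Basis. (h \<bullet> b) * D b)"
    by (rule linear_eq_sum_Basis[OF assms])
  also have "\<bar>\<dots>\<bar> \<le> (\<Sum>b\<in>Basis. \<bar>h \<bullet> b\<bar> * \<bar>D b\<bar>)"
    by (rule order_trans[OF sum_abs]) (simp add: abs_mult)
  also have "\<dots> \<le> L2_set (\<lambda>b. h \<bullet> b) Basis * L2_set D Basis" by (rule L2_set_mult_ineq)
  also have "L2_set (\<lambda>b. h \<bullet> b) Basis = norm h"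
    by (simp add: L2_set_def norm_sq_eq_sum_Basis[symmetric])
  finally show ?thesis by (simp add: L2_set_def mult.commute)
qed

text \<open>The loss \<open>\<epsilon> g - inf_conv \<kappa> (\<epsilon> g)\<close> is \<open>\<epsilon>\<^sup>2 |\<nabla>g|\<^sup>2 / \<kappa>\<close> to leading order: the near-optimal \<open>y\<close>
  lie at distance \<open>O(\<epsilon>)\<close> from \<open>x\<close>.\<close>

lemma inf_conv_defect_le:
  fixes g :: "'a::real_normed_vector \<Rightarrow> real"
  assumes lip: "\<And>x y. \<bar>g x - g y\<bar> \<le> L * norm (x - y)" and \<kappa>: "0 < \<kappa>"
    and D: "(g has_derivative D) (at x)" "\<And>h. \<bar>D h\<bar> \<le> d * norm h"
    and \<delta>: "0 < \<delta>"
  shows "\<forall>\<^sub>F \<epsilon> in at_right 0. (\<epsilon> * g x - inf_conv \<kappa> (\<lambda>y. \<epsilon> * g y) x) / \<epsilon>\<^sup>2 \<le> (d + \<delta>)\<^sup>2 / \<kappa>"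
proof -
  obtain \<eta> where \<eta>: "0 < \<eta>" "\<And>y. norm (y - x) < \<eta> \<Longrightarrow> \<bar>g y - g x - D (y - x)\<bar> \<le> \<delta> * norm (y - x)"
    using D(1) \<delta> unfolding has_derivative_at_alt by (metis real_norm_def)
  \<comment> \<open>Beyond distance K \<epsilon> the quadratic cost outweighs the gain \<epsilon>
    |L| r allowed by the Lipschitz bound; within it, \<epsilon> < \<eta> / K puts y where the
    derivative approximates g. The summand 1 keeps K positive for L = 0.\<close>
  define K where "K = 4 * \<bar>L\<bar> / \<kappa> + 1"
  have K: "0 < K" using \<kappa> by (simp add: K_def add_nonneg_pos)
  have "\<forall>\<^sub>F \<epsilon> in at_right (0::real). \<epsilon> < \<eta> / K"
    using \<eta> K by (intro eventually_at_right_less[THEN eventually_mono] eventually_at_rightI[of 0 "\<eta> / K"]) auto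
  then show ?thesis
    using eventually_at_right_less[of 0]
  proof eventually_elim
    case (elim \<epsilon>)
    have bound: "\<epsilon> * g x - \<epsilon>\<^sup>2 * ((d + \<delta>)\<^sup>2 / \<kappa>) \<le> \<epsilon> * g y + \<kappa> / 4 * (norm (x - y))\<^sup>2" for y
    proof (cases "norm (x - y) < K * \<epsilon>")
      case True
      let ?r = "norm (x - y)"
      have "norm (y - x) < \<eta>"
        using True elim K by (simp add: norm_minus_commute field_simps)
      from \<eta>(2)[OF this] have "g x - g y \<le> - D (y - x) + \<delta> * ?r"
        by (simp add: norm_minus_commute)
      also have "\<dots> \<le> (d + \<delta>) * ?r"
        using D(2)[of "y - x"] by (simp add: norm_minus_commute algebra_simps)
      finally have "\<epsilon> * (g x - g y) \<le> \<epsilon> * ((d + \<delta>) * ?r)" using elim by simp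
      moreover have "\<epsilon> * (d + \<delta>) * ?r - \<epsilon>\<^sup>2 * ((d + \<delta>)\<^sup>2 / \<kappa>) \<le> \<kappa> / 4 * ?r\<^sup>2"
        using quadratic_lower_bound[OF \<kappa>, of "\<epsilon> * (d + \<delta>)" ?r] by (simp add: power_mult_distrib)
      ultimately show ?thesis by (simp add: algebra_simps)
    next
      case False
      let ?r = "norm (x - y)"
      have "\<epsilon> * (g x - g y) \<le> \<epsilon> * (\<bar>L\<bar> * ?r)"
        using elim lip[of x y] mult_right_mono[OF abs_ge_self[of L] norm_ge_zero[of "x - y"]]
        by (intro mult_left_mono) linarith+
      also have "\<dots> = (\<epsilon> * \<bar>L\<bar>) * ?r" by simp
      also have "\<dots> \<le> (\<kappa> / 4 * ?r) * ?r"
      proof (intro mult_right_mono)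
        have "\<epsilon> * \<bar>L\<bar> \<le> \<kappa> / 4 * (K * \<epsilon>)" using \<kappa> elim by (simp add: K_def field_simps)
        also have "\<dots> \<le> \<kappa> / 4 * ?r" using \<kappa> False by (intro mult_left_mono) auto
        finally show "\<epsilon> * \<bar>L\<bar> \<le> \<kappa> / 4 * ?r" .
      qed simp
      finally have "\<epsilon> * (g x - g y) \<le> \<kappa> / 4 * ?r\<^sup>2" by (simp add: power2_eq_square)
      moreover have "0 \<le> \<epsilon>\<^sup>2 * ((d + \<delta>)\<^sup>2 / \<kappa>)" using \<kappa> by simp
      ultimately show ?thesis by (simp add: algebra_simps)
    qed
    have "\<epsilon> * g x - \<epsilon>\<^sup>2 * ((d + \<delta>)\<^sup>2 / \<kappa>) \<le> inf_conv \<kappa> (\<lambda>y. \<epsilon> * g y) x"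
      unfolding inf_conv_def using bound by (intro cINF_greatest) auto
    then show ?case using elim by (simp add: field_simps)
  qed
qed

section \<open>The Poincare inequality\<close>

lemma lipschitz_linear_growth:
  fixes g :: "'a::real_normed_vector \<Rightarrow> real"
  assumes lip: "\<And>x y. \<bar>g x - g y\<bar> \<le> L * norm (x - y)"
  shows "\<bar>g x\<bar> \<le> (\<bar>g 0\<bar> + \<bar>L\<bar>) * (1 + norm x)"
proof -
  have "\<bar>g x\<bar> \<le> \<bar>g 0\<bar> + L * norm x" using lip[of x 0] by simp
  also have "\<dots> \<le> \<bar>g 0\<bar> + \<bar>L\<bar> * norm x" by (simp add: mult_right_mono)
  also have "\<dots> \<le> (\<bar>g 0\<bar> + \<bar>L\<bar>) * (1 + norm x)" by (simp add: algebra_simps)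
  finally show ?thesis .
qed

lemma lipschitz_measurable:
  fixes g :: "'a::euclidean_space \<Rightarrow> real"
  assumes lip: "\<And>x y. \<bar>g x - g y\<bar> \<le> L * norm (x - y)"
  shows "g \<in> borel_measurable borel"
proof -
  have "\<bar>L\<bar>-lipschitz_on UNIV g"
  proof (rule lipschitz_onI)
    show "dist (g x) (g y) \<le> \<bar>L\<bar> * dist x y" for x y
      using lip[of x y] mult_right_mono[OF abs_ge_self[of L] norm_ge_zero[of "x - y"]]
      by (simp add: dist_norm)
  qed simp
  then show ?thesis by (intro borel_measurable_continuous_onI lipschitz_on_continuous_on)
qed

text \<open>Here s will be a second moment, \<rho> the mean defect of the envelope, and a, b the
  expectations of minorants of the two exponentials. Expanding a b \<le> 1 leaves \<epsilon>^2 (s -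
  \<rho>) bounded by a multiple of \<epsilon>^3. As \<rho> will itself depend on \<epsilon>, the
  constants are uniform over 0 \<le> \<rho> \<le> K.\<close>

lemma second_order_expansion:
  fixes s C K :: real
  assumes "0 \<le> s" "0 \<le> C" "0 \<le> K"
  shows "\<exists>T \<epsilon>\<^sub>0. 0 < \<epsilon>\<^sub>0 \<and> \<epsilon>\<^sub>0 \<le> 1 \<and> (\<forall>\<epsilon> \<rho>. 0 < \<epsilon> \<longrightarrow> \<epsilon> < \<epsilon>\<^sub>0 \<longrightarrow> 0 \<le> \<rho> \<longrightarrow> \<rho> \<le> K \<longrightarrow>
    (let a = 1 + \<epsilon>\<^sup>2 * (s / 2 - \<rho>) - \<epsilon> ^ 3 * C; b = 1 + \<epsilon>\<^sup>2 * (s / 2) - \<epsilon> ^ 3 * C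
     in 0 \<le> a \<and> 0 \<le> b \<and> (a * b \<le> 1 \<longrightarrow> s \<le> \<rho> + T * \<epsilon>)))"
proof -
  \<comment> \<open>This T bounds |A| and |B|, and \<epsilon> < 1 / (T + 1) keeps both factors
    nonnegative. In the constant of the conclusion, 2 C comes from A + B and T^2 from the product A
    B.\<close>
  define T where "T = s + K + C"
  have T: "0 \<le> T" using assms by (simp add: T_def)
  have main: "0 \<le> 1 + \<epsilon>\<^sup>2 * (s / 2 - \<rho>) - \<epsilon> ^ 3 * C \<and> 0 \<le> 1 + \<epsilon>\<^sup>2 * (s / 2) - \<epsilon> ^ 3 * C \<and>
    ((1 + \<epsilon>\<^sup>2 * (s / 2 - \<rho>) - \<epsilon> ^ 3 * C) * (1 + \<epsilon>\<^sup>2 * (s / 2) - \<epsilon> ^ 3 * C) \<le> 1 \<longrightarrow> s \<le> \<rho> + (2 * C + T\<^sup>2) * \<epsilon>)"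
    if \<epsilon>: "0 < \<epsilon>" "\<epsilon> < 1 / (T + 1)" and \<rho>: "0 \<le> \<rho>" "\<rho> \<le> K" for \<epsilon> \<rho>
  proof -
    have e1: "\<epsilon> \<le> 1" using \<epsilon> T by (simp add: field_simps) (smt (verit) mult_nonneg_nonneg)
    have eT: "\<epsilon> * T < 1" using \<epsilon> T by (simp add: field_simps)
    have eC: "0 \<le> \<epsilon> * C" "\<epsilon> * C \<le> C" using \<epsilon> e1 assms by (auto intro: mult_left_le_one_le)
    define A B where "A = s / 2 - \<rho> - \<epsilon> * C" and "B = s / 2 - \<epsilon> * C"
    have AB: "\<bar>A\<bar> \<le> T" "\<bar>B\<bar> \<le> T"
      using eC assms \<rho> by (auto simp: A_def B_def T_def)
    have eq: "1 + \<epsilon>\<^sup>2 * (s / 2 - \<rho>) - \<epsilon> ^ 3 * C = 1 + \<epsilon>\<^sup>2 * A" "1 + \<epsilon>\<^sup>2 * (s / 2) - \<epsilon> ^ 3 * C = 1 + \<epsilon>\<^sup>2 * B"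
      by (simp_all add: A_def B_def algebra_simps power2_eq_square power3_eq_cube)
    have "\<epsilon>\<^sup>2 * T \<le> \<epsilon> * T" using \<epsilon> e1 T by (simp add: power2_eq_square mult_right_mono mult_left_le_one_le)
    then have e2T: "\<epsilon>\<^sup>2 * T \<le> 1" using eT by simp
    have "\<bar>\<epsilon>\<^sup>2 * A\<bar> \<le> \<epsilon>\<^sup>2 * T" "\<bar>\<epsilon>\<^sup>2 * B\<bar> \<le> \<epsilon>\<^sup>2 * T" using AB by (auto simp: abs_mult intro: mult_left_mono)
    then have pos: "0 \<le> 1 + \<epsilon>\<^sup>2 * A" "0 \<le> 1 + \<epsilon>\<^sup>2 * B" using e2T by linarith+
    have "s \<le> \<rho> + (2 * C + T\<^sup>2) * \<epsilon>" if "(1 + \<epsilon>\<^sup>2 * A) * (1 + \<epsilon>\<^sup>2 * B) \<le> 1"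
    proof -
      have "\<epsilon>\<^sup>2 * (A + B + \<epsilon>\<^sup>2 * (A * B)) \<le> \<epsilon>\<^sup>2 * 0" using that by (simp add: algebra_simps)
      then have "A + B + \<epsilon>\<^sup>2 * (A * B) \<le> 0" using \<epsilon> by (simp only: mult_le_cancel_left_pos zero_less_power)
      moreover have "\<bar>A * B\<bar> \<le> T\<^sup>2"
        using AB T by (simp add: abs_mult power2_eq_square mult_mono)
      then have "\<bar>\<epsilon>\<^sup>2 * (A * B)\<bar> \<le> \<epsilon>\<^sup>2 * T\<^sup>2" by (simp add: abs_mult mult_left_mono)
      moreover have "\<epsilon>\<^sup>2 * T\<^sup>2 \<le> \<epsilon> * T\<^sup>2"
        using \<epsilon> e1 by (intro mult_right_mono) (auto simp: power2_eq_square mult_left_le_one_le)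
      ultimately show ?thesis by (simp add: A_def B_def algebra_simps)
    qed
    then show ?thesis using pos unfolding eq by blast
  qed
  have "0 < 1 / (T + 1)" "1 / (T + 1) \<le> 1" using T by auto
  then show ?thesis using main
    by (intro exI[of _ "2 * C + T\<^sup>2"] exI[of _ "1 / (T + 1)"]) (auto simp: Let_def)
qed

text \<open>Midpoint form of strong log-concavity: if w = exp (-U) and U is strongly convex with
  modulus \<kappa>, then U x + U y - 2 U ((x + y) / 2) is at least \<kappa> / 4 |x - y|^2. The third
  moment makes the cubic error terms of the expansions in \<epsilon> integrable.\<close>

locale strongly_log_concave =
  fixes w :: "'a::euclidean_space \<Rightarrow> real" and \<kappa> :: real
  assumes w_measurable [measurable]: "w \<in> borel_measurable borel"
    and w_nonneg: "0 \<le> w x"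
    and slc: "w x * w y * exp (\<kappa> / 4 * (norm (x - y))\<^sup>2) \<le> (w ((x + y) /\<^sub>R 2))\<^sup>2"
    and \<kappa>: "0 < \<kappa>"
    and prob: "prob_space (density lborel (\<lambda>x. ennreal (w x)))"
    and moment3: "integrable (density lborel (\<lambda>x. ennreal (w x))) (\<lambda>x. norm x ^ 3)"
begin

abbreviation \<mu> :: "'a measure" where "\<mu> \<equiv> density lborel (\<lambda>x. ennreal (w x))"

sublocale prob_space \<mu> by (rule prob)

lemma prob_UNIV [simp]: "prob UNIV = 1"
  using prob_space by simp

lemma integrable_cubic_growth:
  fixes f :: "'a \<Rightarrow> 'b::{banach, second_countable_topology}"
  assumes [measurable]: "f \<in> borel_measurable borel"
    and f: "\<And>x. norm (f x) \<le> C * (1 + norm x) ^ 3"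
  shows "integrable \<mu> f"
proof (rule Bochner_Integration.integrable_bound)
  show "integrable \<mu> (\<lambda>x. C * 8 * (1 + norm x ^ 3))" using moment3 by simp
  have C: "0 \<le> C" using f[of 0] by (auto intro: order_trans[OF norm_ge_zero])
  have "norm (f x) \<le> norm (C * 8 * (1 + norm x ^ 3))" for x
  proof -
    have "(1 + norm x) ^ 3 \<le> 8 * (1 + norm x ^ 3)"
    proof (cases "norm x \<le> 1")
      case True
      then have "(1 + norm x) ^ 3 \<le> 2 ^ 3" by (intro power_mono) auto
      also have "\<dots> \<le> 8 * (1 + norm x ^ 3)" by simp
      finally show ?thesis .
    next
      case False
      then have "(1 + norm x) ^ 3 \<le> (2 * norm x) ^ 3" by (intro power_mono) auto
      then show ?thesis by (simp add: power_mult_distrib)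
    qed
    then have "C * (1 + norm x) ^ 3 \<le> C * (8 * (1 + norm x ^ 3))" using C by (rule mult_left_mono)
    moreover have nonneg: "0 \<le> C * 8 * (1 + norm x ^ 3)" using C by simp
    ultimately show ?thesis
      unfolding real_norm_def abs_of_nonneg[OF nonneg] using f[of x] by (simp only: mult.assoc)
  qed
  then show "AE x in \<mu>. norm (f x) \<le> norm (C * 8 * (1 + norm x ^ 3))" by simp
qed simp

lemma integrable_linear_growth_power:
  fixes f :: "'a \<Rightarrow> real"
  assumes [measurable]: "f \<in> borel_measurable borel"
    and f: "\<And>x. \<bar>f x\<bar> \<le> C * (1 + norm x)" and k: "k \<le> 3"
  shows "integrable \<mu> (\<lambda>x. f x ^ k)"
proof (rule integrable_cubic_growth)
  have C: "0 \<le> C" using f[of 0] by (auto intro: order_trans[OF abs_ge_zero])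
  show "norm (f x ^ k) \<le> C ^ k * (1 + norm x) ^ 3" for x
  proof -
    have "norm (f x ^ k) \<le> (C * (1 + norm x)) ^ k"
      using f by (simp add: power_abs power_mono)
    also have "\<dots> \<le> C ^ k * (1 + norm x) ^ 3"
      using C k by (auto simp: power_mult_distrib intro!: mult_left_mono power_increasing)
    finally show ?thesis .
  qed
qed simp

lemma integrable_lipschitz_mult:
  assumes f: "\<And>x y. \<bar>f x - f y\<bar> \<le> K * norm (x - y)" and g: "\<And>x y. \<bar>g x - g y\<bar> \<le> L * norm (x - y)"
  shows "integrable \<mu> (\<lambda>x. f x * g x :: real)"
proof (rule integrable_cubic_growth)
  note [measurable] = lipschitz_measurable[OF f] lipschitz_measurable[OF g]
  show "(\<lambda>x. f x * g x) \<in> borel_measurable borel" by measurable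
  fix x
  have "norm (f x * g x) \<le> ((\<bar>f 0\<bar> + \<bar>K\<bar>) * (1 + norm x)) * ((\<bar>g 0\<bar> + \<bar>L\<bar>) * (1 + norm x))"
    using lipschitz_linear_growth[OF f, of x] lipschitz_linear_growth[OF g, of x]
    by (simp add: abs_mult mult_mono)
  also have "\<dots> = ((\<bar>f 0\<bar> + \<bar>K\<bar>) * (\<bar>g 0\<bar> + \<bar>L\<bar>)) * (1 + norm x)\<^sup>2"
    by (simp add: power2_eq_square)
  also have "\<dots> \<le> ((\<bar>f 0\<bar> + \<bar>K\<bar>) * (\<bar>g 0\<bar> + \<bar>L\<bar>)) * (1 + norm x) ^ 3"
    by (intro mult_left_mono power_increasing) auto
  finally show "norm (f x * g x) \<le> ((\<bar>f 0\<bar> + \<bar>K\<bar>) * (\<bar>g 0\<bar> + \<bar>L\<bar>)) * (1 + norm x) ^ 3" .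
qed

text \<open>Integrable minorants spare any exponential moment, since the exponentials are integrated
  only in \<open>ennreal\<close>, where infinity is allowed. A minorant may be negative at some
  points, hence the passage through its positive part.\<close>

lemma expectation_exp_minorants:
  assumes [measurable]: "g \<in> borel_measurable borel" "q \<in> borel_measurable borel"
    and q: "\<And>x y. q x \<le> g y + \<kappa> / 4 * (norm (x - y))\<^sup>2"
    and int: "integrable \<mu> f1" "integrable \<mu> f2"
    and le: "\<And>x. f1 x \<le> exp (q x)" "\<And>x. f2 x \<le> exp (- g x)"
    and pos: "0 \<le> expectation f1" "0 \<le> expectation f2"
  shows "expectation f1 * expectation f2 \<le> 1"
proof -
  have minorant: "ennreal (expectation f) \<le> (\<integral>\<^sup>+x. ennreal (h x) \<partial>\<mu>)"
    if "integrable \<mu> f" "\<And>x. f x \<le> h x" "\<And>x. 0 \<le> h x" for f h :: "'a \<Rightarrow> real"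
  proof -
    have "ennreal (expectation f) \<le> ennreal (expectation (\<lambda>x. max 0 (f x)))"
      using that by (intro ennreal_leI integral_mono) auto
    also have "\<dots> = (\<integral>\<^sup>+x. ennreal (max 0 (f x)) \<partial>\<mu>)"
      using that by (intro nn_integral_eq_integral[symmetric]) auto
    also have "\<dots> \<le> (\<integral>\<^sup>+x. ennreal (h x) \<partial>\<mu>)"
      using that by (intro nn_integral_mono ennreal_leI) auto
    finally show ?thesis .
  qed
  have "ennreal (expectation f1 * expectation f2)
      \<le> (\<integral>\<^sup>+x. exp (q x) \<partial>\<mu>) * (\<integral>\<^sup>+x. exp (- g x) \<partial>\<mu>)"
    using minorant[OF int(1) le(1)] minorant[OF int(2) le(2)] pos by (simp add: ennreal_mult mult_mono)
  also have "\<dots> \<le> 1"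
    by (rule property_tau[OF _ _ _ w_nonneg slc q prob]) measurable
  finally show ?thesis by simp
qed

text \<open>With R the scaled defect, the envelope is \<epsilon> g - \<epsilon>^2 R and 0 \<le> R
  \<le> L^2 / \<kappa>. In the product of the two expectations the first-order terms vanish because
  g is centred, and order \<epsilon>^2 compares E g^2 with E R.\<close>

lemma second_moment_le_inf_conv_defect:
  fixes g :: "'a \<Rightarrow> real"
  assumes lip: "\<And>x y. \<bar>g x - g y\<bar> \<le> L * norm (x - y)" and centred: "expectation g = 0"
  shows "\<exists>T. \<forall>\<^sub>F \<epsilon> in at_right 0. expectation (\<lambda>x. (g x)\<^sup>2)
    \<le> expectation (\<lambda>x. (\<epsilon> * g x - inf_conv \<kappa> (\<lambda>y. \<epsilon> * g y) x) / \<epsilon>\<^sup>2) + T * \<epsilon>"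
proof -
  define R where "R \<epsilon> x = (\<epsilon> * g x - inf_conv \<kappa> (\<lambda>y. \<epsilon> * g y) x) / \<epsilon>\<^sup>2" for \<epsilon> x
  define K where "K = L\<^sup>2 / \<kappa>"
  \<comment> \<open>Third-order error: the first summand bounds the cross term g R in the square of
    the envelope, the second its cube, where \<epsilon> \<le> 1 gives |g - \<epsilon> R| \<le> |g| +
    K.\<close>
  define c where "c x = \<bar>g x\<bar> * K + (\<bar>g x\<bar> + K) ^ 3" for x
  have [measurable]: "g \<in> borel_measurable borel" by (rule lipschitz_measurable[OF lip])
  have K: "0 \<le> K" using \<kappa> by (simp add: K_def)
  have lip\<epsilon>: "\<bar>\<epsilon> * g x - \<epsilon> * g y\<bar> \<le> (\<epsilon> * L) * norm (x - y)" if "0 < \<epsilon>" for \<epsilon> x y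
    using lip[of x y] that by (simp add: abs_mult flip: right_diff_distrib)
  note ic_meas = borel_measurable_continuous_onI[OF continuous_on_inf_conv[OF lip\<epsilon> \<kappa>]]
  have R_meas: "R \<epsilon> \<in> borel_measurable borel" if "0 < \<epsilon>" for \<epsilon>
    unfolding R_def using ic_meas[OF that] by measurable
  have R: "0 \<le> R \<epsilon> x" "R \<epsilon> x \<le> K" if "0 < \<epsilon>" for \<epsilon> x
    using inf_conv_le_self[OF lip\<epsilon>[OF that] \<kappa>, of x] inf_conv_ge[OF lip\<epsilon>[OF that] \<kappa>, of x] that
    by (auto simp: R_def K_def field_simps power_mult_distrib)
  have growth: "\<bar>g x\<bar> \<le> (\<bar>g 0\<bar> + \<bar>L\<bar>) * (1 + norm x)" for x
    by (rule lipschitz_linear_growth[OF lip])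
  have int_g: "integrable \<mu> g" "integrable \<mu> (\<lambda>x. (g x)\<^sup>2)"
    using integrable_linear_growth_power[OF _ growth, of 1] integrable_linear_growth_power[OF _ growth, of 2] by simp_all
  have int_R: "integrable \<mu> (R \<epsilon>)" if "0 < \<epsilon>" for \<epsilon>
    using R[OF that] R_meas[OF that] by (intro integrable_const_bound[of _ K]) auto
  have growthK: "\<bar>\<bar>g x\<bar> + K\<bar> \<le> (\<bar>g 0\<bar> + \<bar>L\<bar> + K) * (1 + norm x)" for x
  proof -
    have "0 \<le> K * norm x" using K by simp
    moreover have "\<bar>\<bar>g x\<bar> + K\<bar> = \<bar>g x\<bar> + K" using K by simp
    ultimately show ?thesis
      unfolding distrib_right[of _ K] using growth[of x] by (simp only: distrib_left)
  qed
  have int_c: "integrable \<mu> c"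
    unfolding c_def using integrable_linear_growth_power[OF _ growthK, of 3] int_g(1) by simp
  have c0: "0 \<le> c x" for x using K by (simp add: c_def)
  define s C where "s = expectation (\<lambda>x. (g x)\<^sup>2)" and "C = expectation c"
  have "0 \<le> s" "0 \<le> C" using c0 by (auto simp: s_def C_def)
  from second_order_expansion[OF this K] obtain T \<epsilon>\<^sub>0 where T: "0 < \<epsilon>\<^sub>0" "\<epsilon>\<^sub>0 \<le> 1"
    "\<And>\<epsilon> \<rho>. 0 < \<epsilon> \<Longrightarrow> \<epsilon> < \<epsilon>\<^sub>0 \<Longrightarrow> 0 \<le> \<rho> \<Longrightarrow> \<rho> \<le> K \<Longrightarrow>
      0 \<le> 1 + \<epsilon>\<^sup>2 * (s / 2 - \<rho>) - \<epsilon> ^ 3 * C \<and> 0 \<le> 1 + \<epsilon>\<^sup>2 * (s / 2) - \<epsilon> ^ 3 * C \<and>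
      ((1 + \<epsilon>\<^sup>2 * (s / 2 - \<rho>) - \<epsilon> ^ 3 * C) * (1 + \<epsilon>\<^sup>2 * (s / 2) - \<epsilon> ^ 3 * C) \<le> 1 \<longrightarrow> s \<le> \<rho> + T * \<epsilon>)"
    unfolding Let_def by metis
  have main: "s \<le> expectation (R \<epsilon>) + T * \<epsilon>" if \<epsilon>: "0 < \<epsilon>" "\<epsilon> < \<epsilon>\<^sub>0" for \<epsilon>
  proof -
    let ?Q = "inf_conv \<kappa> (\<lambda>y. \<epsilon> * g y)"
    have e1: "\<epsilon> \<le> 1" using \<epsilon> T by simp
    define f1 where "f1 x = 1 + \<epsilon> * g x - \<epsilon>\<^sup>2 * R \<epsilon> x + \<epsilon>\<^sup>2 / 2 * (g x)\<^sup>2 - \<epsilon> ^ 3 * c x" for x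
    define f2 where "f2 x = 1 - \<epsilon> * g x + \<epsilon>\<^sup>2 / 2 * (g x)\<^sup>2 - \<epsilon> ^ 3 * c x" for x
    have f1: "f1 x \<le> exp (?Q x)" for x
    proof -
      let ?r = "R \<epsilon> x"
      have Q: "?Q x = \<epsilon> * (g x - \<epsilon> * ?r)" using \<epsilon> by (simp add: R_def field_simps power2_eq_square)
      have r: "0 \<le> ?r" "?r \<le> K" "\<epsilon> * ?r \<le> K"
        using R[OF \<epsilon>(1), of x] e1 \<epsilon> by (auto intro: order_trans[OF mult_left_le_one_le])
      have "\<bar>g x * ?r\<bar> \<le> \<bar>g x\<bar> * K" using r by (simp add: abs_mult mult_left_mono)
      then have "(g x)\<^sup>2 - 2 * \<epsilon> * (\<bar>g x\<bar> * K) \<le> (g x)\<^sup>2 - 2 * \<epsilon> * (g x * ?r)"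
        using \<epsilon> by (simp add: mult_left_mono abs_le_iff)
      also have "\<dots> \<le> (g x)\<^sup>2 - 2 * \<epsilon> * (g x * ?r) + (\<epsilon> * ?r)\<^sup>2" by simp
      also have "\<dots> = (g x - \<epsilon> * ?r)\<^sup>2" by (simp add: power2_eq_square algebra_simps)
      finally have 2: "\<epsilon>\<^sup>2 / 2 * ((g x)\<^sup>2 - 2 * \<epsilon> * (\<bar>g x\<bar> * K)) \<le> (?Q x)\<^sup>2 / 2"
        unfolding Q power_mult_distrib by (simp add: mult_left_mono)
      have "\<bar>g x - \<epsilon> * ?r\<bar> \<le> \<bar>g x\<bar> + K" using r \<epsilon> mult_nonneg_nonneg[of \<epsilon> ?r] by linarith
      then have "\<bar>g x - \<epsilon> * ?r\<bar> ^ 3 \<le> (\<bar>g x\<bar> + K) ^ 3" by (intro power_mono) auto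
      then have "- ((\<bar>g x\<bar> + K) ^ 3) \<le> (g x - \<epsilon> * ?r) ^ 3"
        unfolding power_abs[symmetric] by (simp add: abs_le_iff)
      then have "\<epsilon> ^ 3 * (- ((\<bar>g x\<bar> + K) ^ 3)) \<le> (?Q x) ^ 3"
        unfolding Q power_mult_distrib using \<epsilon> by (intro mult_left_mono) auto
      moreover have "0 \<le> \<epsilon> ^ 3 * (\<bar>g x\<bar> + K) ^ 3" using \<epsilon> K by simp
      ultimately have 3: "- (\<epsilon> ^ 3 * (\<bar>g x\<bar> + K) ^ 3) \<le> (?Q x) ^ 3 / 6" by simp
      have "f1 x \<le> 1 + ?Q x + (?Q x)\<^sup>2 / 2 + (?Q x) ^ 3 / 6"
      proof -
        have "f1 x = 1 + ?Q x + \<epsilon>\<^sup>2 / 2 * ((g x)\<^sup>2 - 2 * \<epsilon> * (\<bar>g x\<bar> * K)) + - (\<epsilon> ^ 3 * (\<bar>g x\<bar> + K) ^ 3)"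
          unfolding f1_def c_def Q by (simp add: algebra_simps power2_eq_square power3_eq_cube)
        then show ?thesis using 2 3 by linarith
      qed
      also note exp_ge_cubic
      finally show ?thesis .
    qed
    have f2: "f2 x \<le> exp (- (\<epsilon> * g x))" for x
    proof -
      have "(g x) ^ 3 \<le> \<bar>g x\<bar> ^ 3" by (simp add: power_abs[symmetric])
      also have "\<dots> \<le> (\<bar>g x\<bar> + K) ^ 3" using K by (intro power_mono) auto
      also have "\<dots> \<le> c x" using K by (simp add: c_def)
      finally have "\<epsilon> ^ 3 * (g x) ^ 3 \<le> \<epsilon> ^ 3 * c x" using \<epsilon> by simp
      moreover have "0 \<le> \<epsilon> ^ 3 * c x" using c0 \<epsilon> by simp
      ultimately have "f2 x \<le> 1 + (- (\<epsilon> * g x)) + (- (\<epsilon> * g x))\<^sup>2 / 2 + (- (\<epsilon> * g x)) ^ 3 / 6"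
        by (simp add: f2_def power_mult_distrib)
      also note exp_ge_cubic
      finally show ?thesis .
    qed
    have int: "integrable \<mu> f1" "integrable \<mu> f2"
      unfolding f1_def f2_def using int_g int_c int_R[OF \<epsilon>(1)] by simp_all
    have E: "expectation f1 = 1 + \<epsilon>\<^sup>2 * (s / 2 - expectation (R \<epsilon>)) - \<epsilon> ^ 3 * C"
      "expectation f2 = 1 + \<epsilon>\<^sup>2 * (s / 2) - \<epsilon> ^ 3 * C"
      unfolding f1_def f2_def using int_g int_c int_R[OF \<epsilon>(1)]
      by (simp_all add: centred s_def C_def algebra_simps)
    have \<rho>: "0 \<le> expectation (R \<epsilon>)" "expectation (R \<epsilon>) \<le> K"
      using R[OF \<epsilon>(1)] int_R[OF \<epsilon>(1)] by (auto intro!: integral_le_const)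
    note T' = T(3)[OF \<epsilon> \<rho>]
    have "expectation f1 * expectation f2 \<le> 1"
    proof (rule expectation_exp_minorants[OF _ ic_meas[OF \<epsilon>(1)] inf_conv_le[OF lip\<epsilon>[OF \<epsilon>(1)] \<kappa>] int f1 f2])
      show "0 \<le> expectation f1" "0 \<le> expectation f2" using T' by (auto simp: E)
    qed measurable
    then show ?thesis using T' by (auto simp: E)
  qed
  have "\<forall>\<^sub>F \<epsilon> in at_right 0. s \<le> expectation (R \<epsilon>) + T * \<epsilon>"
    using T(1) main by (auto simp: eventually_at_right_field)
  then show ?thesis unfolding s_def R_def by blast
qed

text \<open>Bounding each variance by its own Lipschitz constant instead would cost a power of the dimension:
  the Frobenius norm controls the sum of the squared gradients only pointwise.\<close>

theorem poincare_inequality: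
  fixes g :: "'i \<Rightarrow> 'a \<Rightarrow> real" and D :: "'i \<Rightarrow> 'a \<Rightarrow> 'a \<Rightarrow> real"
  assumes I: "finite I"
    and lip: "\<And>i x y. i \<in> I \<Longrightarrow> \<bar>g i x - g i y\<bar> \<le> L * norm (x - y)"
    and D: "\<And>i x. i \<in> I \<Longrightarrow> (g i has_derivative D i x) (at x)"
    and B: "\<And>x. (\<Sum>i\<in>I. \<Sum>b\<in>Basis. (D i x b)\<^sup>2) \<le> B"
  shows "(\<Sum>i\<in>I. variance (g i)) \<le> B / \<kappa>"
proof -
  define h where "h i x = g i x - expectation (g i)" for i x
  define R where "R i \<epsilon> x = (\<epsilon> * h i x - inf_conv \<kappa> (\<lambda>y. \<epsilon> * h i y) x) / \<epsilon>\<^sup>2" for i \<epsilon> x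
  \<comment> \<open>Pointwise, only an upper bound on the limiting defects is available. Taking the
    maximum with B / \<kappa> forces convergence to that value, so that dominated convergence
    applies.\<close>
  define S where "S \<epsilon> x = max (\<Sum>i\<in>I. R i \<epsilon> x) (B / \<kappa>)" for \<epsilon> x
  define K where "K = L\<^sup>2 / \<kappa>"
  have lip_h: "\<bar>h i x - h i y\<bar> \<le> L * norm (x - y)" if "i \<in> I" for i x y
    using lip[OF that] by (simp add: h_def)
  have int_g: "integrable \<mu> (g i)" if "i \<in> I" for i
    using integrable_linear_growth_power[OF lipschitz_measurable[OF lip[OF that]] lipschitz_linear_growth[OF lip[OF that]], of 1]
    by simp
  have centred: "expectation (h i) = 0" if "i \<in> I" for i
    using int_g[OF that] by (simp add: h_def[abs_def])
  have lip\<epsilon>: "\<bar>\<epsilon> * h i x - \<epsilon> * h i y\<bar> \<le> (\<epsilon> * L) * norm (x - y)" if "i \<in> I" "0 < \<epsilon>" for i \<epsilon> x y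
    using lip_h[of i x y] that by (simp add: abs_mult flip: right_diff_distrib)
  have R_meas [measurable]: "R i \<epsilon> \<in> borel_measurable borel" if "i \<in> I" "0 < \<epsilon>" for i \<epsilon>
    unfolding R_def using lipschitz_measurable[OF lip_h[OF that(1)]]
      borel_measurable_continuous_onI[OF continuous_on_inf_conv[OF lip\<epsilon>[OF that] \<kappa>]] by measurable
  have R: "0 \<le> R i \<epsilon> x" "R i \<epsilon> x \<le> K" if "i \<in> I" "0 < \<epsilon>" for i \<epsilon> x
    using inf_conv_le_self[OF lip\<epsilon>[OF that] \<kappa>, of x] inf_conv_ge[OF lip\<epsilon>[OF that] \<kappa>, of x] that
    by (auto simp: R_def K_def field_simps power_mult_distrib)
  have "0 \<le> (\<Sum>i\<in>I. \<Sum>b\<in>Basis. (D i 0 b)\<^sup>2)" by (intro sum_nonneg) auto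
  then have B0: "0 \<le> B / \<kappa>" using B[of 0] \<kappa> by simp
  have K0: "0 \<le> K" using \<kappa> by (simp add: K_def)
  have int_R: "integrable \<mu> (R i \<epsilon>)" if "i \<in> I" "0 < \<epsilon>" for i \<epsilon>
    using R[OF that] R_meas[OF that] by (intro integrable_const_bound[of _ K]) auto
  have S_meas: "S \<epsilon> \<in> borel_measurable borel" if "0 < \<epsilon>" for \<epsilon>
    unfolding S_def using R_meas that by measurable
  have S_bound: "\<bar>S \<epsilon> x\<bar> \<le> real (card I) * K + B / \<kappa>" if "0 < \<epsilon>" for \<epsilon> x
  proof -
    have "(\<Sum>i\<in>I. R i \<epsilon> x) \<le> real (card I) * K"
      using R that by (intro sum_bounded_above) auto
    moreover have "0 \<le> real (card I) * K" using K0 by simp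
    ultimately show ?thesis using B0 by (auto simp: S_def max_def)
  qed
  have "\<exists>T. \<forall>\<^sub>F \<epsilon> in at_right 0. variance (g i) \<le> expectation (R i \<epsilon>) + T * \<epsilon>" if "i \<in> I" for i
  proof -
    have "variance (g i) = expectation (\<lambda>x. (h i x)\<^sup>2)" by (simp only: h_def)
    moreover have "expectation (R i \<epsilon>) = expectation (\<lambda>x. (\<epsilon> * h i x - inf_conv \<kappa> (\<lambda>y. \<epsilon> * h i y) x) / \<epsilon>\<^sup>2)" for \<epsilon>
      by (simp only: R_def[abs_def])
    ultimately show ?thesis
      using second_moment_le_inf_conv_defect[OF lip_h[OF that] centred[OF that]] by (simp only:)
  qed
  then have "\<exists>T. \<forall>i\<in>I. \<forall>\<^sub>F \<epsilon> in at_right 0. variance (g i) \<le> expectation (R i \<epsilon>) + T i * \<epsilon>"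
    by (intro bchoice ballI)
  then obtain T where T: "\<forall>i\<in>I. \<forall>\<^sub>F \<epsilon> in at_right 0. variance (g i) \<le> expectation (R i \<epsilon>) + T i * \<epsilon>" ..
  have "\<forall>\<^sub>F \<epsilon> in at_right 0. \<forall>i\<in>I. variance (g i) \<le> expectation (R i \<epsilon>) + T i * \<epsilon>"
    using T I by (intro eventually_ball_finite)
  then have "\<forall>\<^sub>F \<epsilon> in at_right 0. (\<Sum>i\<in>I. variance (g i)) \<le> expectation (S \<epsilon>) + (\<Sum>i\<in>I. T i) * \<epsilon>"
    using eventually_at_right_less[of 0]
  proof eventually_elim
    case (elim \<epsilon>)
    have "(\<Sum>i\<in>I. variance (g i)) \<le> (\<Sum>i\<in>I. expectation (R i \<epsilon>) + T i * \<epsilon>)"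
      using elim by (intro sum_mono) auto
    also have "\<dots> = expectation (\<lambda>x. \<Sum>i\<in>I. R i \<epsilon> x) + (\<Sum>i\<in>I. T i) * \<epsilon>"
      using int_R elim by (simp add: sum.distrib sum_distrib_right)
    also have "expectation (\<lambda>x. \<Sum>i\<in>I. R i \<epsilon> x) \<le> expectation (S \<epsilon>)"
    proof (rule integral_mono)
      show "integrable \<mu> (S \<epsilon>)"
        using S_bound[of \<epsilon>] S_meas[of \<epsilon>] elim by (intro integrable_const_bound) auto
    qed (use int_R elim in \<open>auto simp: S_def\<close>)
    finally show ?case by simp
  qed
  moreover have "((\<lambda>\<epsilon>. expectation (S \<epsilon>) + (\<Sum>i\<in>I. T i) * \<epsilon>) \<longlongrightarrow> B / \<kappa> + (\<Sum>i\<in>I. T i) * 0) (at_right 0)"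
  proof (intro tendsto_intros)
    have S_lim: "((\<lambda>\<epsilon>. S \<epsilon> x) \<longlongrightarrow> B / \<kappa>) (at_right 0)" for x
    proof (rule order_tendstoI)
      show "\<forall>\<^sub>F \<epsilon> in at_right 0. c < S \<epsilon> x" if "c < B / \<kappa>" for c
        using that by (intro always_eventually) (auto simp: S_def less_max_iff_disj)
    next
      fix c assume c: "B / \<kappa> < c"
      define d where "d i = sqrt (\<Sum>b\<in>Basis. (D i x b)\<^sup>2)" for i
      have "((\<lambda>\<delta>. \<Sum>i\<in>I. (d i + \<delta>)\<^sup>2 / \<kappa>) \<longlongrightarrow> (\<Sum>i\<in>I. (d i + 0)\<^sup>2 / \<kappa>)) (at_right 0)"
        using \<kappa> by (intro tendsto_intros) auto
      moreover have "(\<Sum>i\<in>I. (d i + 0)\<^sup>2 / \<kappa>) < c"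
      proof -
        have "(\<Sum>i\<in>I. (d i + 0)\<^sup>2 / \<kappa>) = (\<Sum>i\<in>I. \<Sum>b\<in>Basis. (D i x b)\<^sup>2) / \<kappa>"
          by (simp add: d_def sum_nonneg flip: sum_divide_distrib)
        also have "\<dots> \<le> B / \<kappa>" using B \<kappa> by (intro divide_right_mono) auto
        finally show ?thesis using c by simp
      qed
      ultimately have "\<forall>\<^sub>F \<delta> in at_right 0. (\<Sum>i\<in>I. (d i + \<delta>)\<^sup>2 / \<kappa>) < c" by (rule order_tendstoD)
      then have "\<forall>\<^sub>F \<delta> in at_right 0. 0 < \<delta> \<and> (\<Sum>i\<in>I. (d i + \<delta>)\<^sup>2 / \<kappa>) < c"
        using eventually_at_right_less[of 0] by eventually_elim auto
      then obtain \<delta> where \<delta>: "0 < \<delta>" "(\<Sum>i\<in>I. (d i + \<delta>)\<^sup>2 / \<kappa>) < c"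
        using eventually_happens' trivial_limit_at_right_real by blast
      have "\<forall>\<^sub>F \<epsilon> in at_right 0. R i \<epsilon> x \<le> (d i + \<delta>)\<^sup>2 / \<kappa>" if i: "i \<in> I" for i
        unfolding R_def
      proof (rule inf_conv_defect_le[OF lip_h[OF i] \<kappa> _ _ \<delta>(1)])
        show "(h i has_derivative D i x) (at x)"
          unfolding h_def using D[OF i] by (auto intro!: derivative_eq_intros)
        show "\<bar>D i x v\<bar> \<le> d i * norm v" for v
          unfolding d_def using D[OF i, of x] by (intro linear_le_l2_norm_Basis) (rule has_derivative_linear)
      qed
      then have "\<forall>\<^sub>F \<epsilon> in at_right 0. \<forall>i\<in>I. R i \<epsilon> x \<le> (d i + \<delta>)\<^sup>2 / \<kappa>"
        using I by (intro eventually_ball_finite ballI)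
      then show "\<forall>\<^sub>F \<epsilon> in at_right 0. S \<epsilon> x < c"
      proof eventually_elim
        case (elim \<epsilon>)
        then have "(\<Sum>i\<in>I. R i \<epsilon> x) \<le> (\<Sum>i\<in>I. (d i + \<delta>)\<^sup>2 / \<kappa>)" by (intro sum_mono) auto
        then show ?case using \<delta> c by (simp add: S_def)
      qed
    qed
    have "((\<lambda>\<epsilon>. expectation (S \<epsilon>)) \<longlongrightarrow> expectation (\<lambda>_. B / \<kappa>)) (at_right 0)"
    proof (rule tendsto_at_right_sequentially[of 0 1])
      fix e :: "nat \<Rightarrow> real" assume e: "\<And>n. 0 < e n" "e \<longlonglongrightarrow> 0"
      have lim: "filterlim e (at_right 0) sequentially"
        using e by (intro tendsto_imp_filterlim_at_right always_eventually) auto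
      show "(\<lambda>n. expectation (S (e n))) \<longlonglongrightarrow> expectation (\<lambda>_. B / \<kappa>)"
      proof (rule integral_dominated_convergence[where w="\<lambda>_. real (card I) * K + B / \<kappa>"])
        show "AE x in \<mu>. (\<lambda>n. S (e n) x) \<longlonglongrightarrow> B / \<kappa>"
          by (intro AE_I2 filterlim_compose[OF S_lim lim])
      qed (use S_meas S_bound e in auto)
    qed simp
    then show "((\<lambda>\<epsilon>. expectation (S \<epsilon>)) \<longlongrightarrow> B / \<kappa>) (at_right 0)" by simp
  qed
  ultimately show ?thesis
    by (intro tendsto_lowerbound[of "\<lambda>\<epsilon>. expectation (S \<epsilon>) + (\<Sum>i\<in>I. T i) * \<epsilon>" _ "at_right 0"]) auto
qed

end

section \<open>Log-concave densities with bounded third derivative\<close>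

lemma linear_sq_le_Basis:
  fixes D :: "'a::euclidean_space \<Rightarrow> real"
  assumes "linear D"
  shows "(D h)\<^sup>2 \<le> (norm h)\<^sup>2 * (\<Sum>b\<in>Basis. (D b)\<^sup>2)"
proof -
  have "\<bar>D h\<bar>\<^sup>2 \<le> (sqrt (\<Sum>b\<in>Basis. (D b)\<^sup>2) * norm h)\<^sup>2"
    by (intro power_mono linear_le_l2_norm_Basis assms) auto
  then show ?thesis by (simp add: power_mult_distrib sum_nonneg mult.commute)
qed

lemma frob3_nonneg: "0 \<le> frob3 T"
  by (auto simp: frob3_def intro!: sum_nonneg)

lemma frob3_power2: "(frob3 T)\<^sup>2 = (\<Sum>i\<in>Basis. \<Sum>j\<in>Basis. \<Sum>k\<in>Basis. (T i j k)\<^sup>2)"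
  unfolding frob3_def by (intro real_sqrt_pow2 sum_nonneg) auto

text \<open>Cauchy--Schwarz is spent on the last slot only. For T = \<open>D3 x\<close> the left
  side is the sum over i of the squared gradients of the functions \<open>D2 x i v\<close> of x, the
  quantity that enters the Poincare inequality.\<close>

lemma sum_trilinear_sq_le:
  fixes T :: "'a::euclidean_space \<Rightarrow>\<^sub>L 'a \<Rightarrow>\<^sub>L 'a \<Rightarrow>\<^sub>L real"
  shows "(\<Sum>i\<in>Basis. \<Sum>b\<in>Basis. (T b i v)\<^sup>2) \<le> (frob3 T)\<^sup>2 * (norm v)\<^sup>2"
proof -
  have "(\<Sum>i\<in>Basis. \<Sum>b\<in>Basis. (T b i v)\<^sup>2)
      \<le> (\<Sum>i\<in>Basis. \<Sum>b\<in>Basis. (norm v)\<^sup>2 * (\<Sum>k\<in>Basis. (T b i k)\<^sup>2))"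
    by (intro sum_mono linear_sq_le_Basis bounded_linear.linear blinfun.bounded_linear_right)
  also have "\<dots> = (norm v)\<^sup>2 * (frob3 T)\<^sup>2"
    unfolding frob3_power2 by (subst sum.swap) (simp add: sum_distrib_left)
  finally show ?thesis by (simp add: mult.commute)
qed

lemma trilinear_le_frob3:
  fixes T :: "'a::euclidean_space \<Rightarrow>\<^sub>L 'a \<Rightarrow>\<^sub>L 'a \<Rightarrow>\<^sub>L real"
  shows "\<bar>T a b v\<bar> \<le> frob3 T * norm a * norm b * norm v"
proof -
  have lin: "linear (\<lambda>a. T a b v)" for b
    by (intro bounded_linear.linear bounded_linear_intros)
  have "(T a b v)\<^sup>2 \<le> (norm b)\<^sup>2 * (\<Sum>i\<in>Basis. (T a i v)\<^sup>2)"
    by (intro linear_sq_le_Basis bounded_linear.linear bounded_linear_intros)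
  also have "\<dots> \<le> (norm b)\<^sup>2 * (\<Sum>i\<in>Basis. (norm a)\<^sup>2 * (\<Sum>c\<in>Basis. (T c i v)\<^sup>2))"
    by (intro mult_left_mono sum_mono linear_sq_le_Basis lin) auto
  also have "\<dots> = (norm b)\<^sup>2 * (norm a)\<^sup>2 * (\<Sum>i\<in>Basis. \<Sum>c\<in>Basis. (T c i v)\<^sup>2)"
    by (simp add: sum_distrib_left mult.assoc)
  also have "\<dots> \<le> (norm b)\<^sup>2 * (norm a)\<^sup>2 * ((frob3 T)\<^sup>2 * (norm v)\<^sup>2)"
    by (intro mult_left_mono sum_trilinear_sq_le) auto
  also have "\<dots> = (frob3 T * norm a * norm b * norm v)\<^sup>2"
    by (simp add: power_mult_distrib)
  finally have "\<bar>T a b v\<bar>\<^sup>2 \<le> (frob3 T * norm a * norm b * norm v)\<^sup>2" by simp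
  then show ?thesis
    by (rule power2_le_imp_le) (simp add: frob3_nonneg)
qed

lemma bounded_linear_blinfun_apply2: "bounded_linear (\<lambda>u. blinfun_apply (blinfun_apply T u) v)"
  by (rule bounded_linear_compose[OF blinfun.bounded_linear_left blinfun.bounded_linear_right])

text \<open>Stands in for differentiation at 0 from the right: an estimate divided by t, with an
  error of order t, passes to the limit.\<close>

lemma le_if_le_plus_small_multiple:
  fixes a b C :: real
  assumes "\<And>t. 0 < t \<Longrightarrow> t \<le> 1 \<Longrightarrow> a \<le> b + C * t"
  shows "a \<le> b"
proof -
  have "((\<lambda>t. b + C * t) \<longlongrightarrow> b + C * 0) (at_right 0)" by (intro tendsto_intros)
  moreover have "\<forall>\<^sub>F t in at_right 0. a \<le> b + C * t"
    using assms by (auto simp: eventually_at_right_field intro!: exI[of _ 1])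
  ultimately show ?thesis by (intro tendsto_lowerbound[of "\<lambda>t. b + C * t" b "at_right 0"]) auto
qed

section \<open>Taylor estimates and concavity of the log-density\<close>

locale smooth_log_concave_density =
  fixes p :: "'a::euclidean_space \<Rightarrow> real"
    and D1 :: "'a \<Rightarrow> ('a \<Rightarrow>\<^sub>L real)"
    and D2 :: "'a \<Rightarrow> ('a \<Rightarrow>\<^sub>L 'a \<Rightarrow>\<^sub>L real)"
    and D3 :: "'a \<Rightarrow> ('a \<Rightarrow>\<^sub>L 'a \<Rightarrow>\<^sub>L 'a \<Rightarrow>\<^sub>L real)"
    and M :: real
  assumes density: "(p has_integral 1) UNIV"
    and pos: "0 < p x"
    and logconc: "concave_on UNIV (\<lambda>x. ln (p x))"
    and d1: "((\<lambda>x. ln (p x)) has_derivative D1 x) (at x)"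
    and d2: "(D1 has_derivative D2 x) (at x)"
    and d3: "(D2 has_derivative D3 x) (at x)"
    and D3_le: "frob3 (D3 x) \<le> M"
begin

lemma M_nonneg: "0 \<le> M"
  using frob3_nonneg D3_le order_trans by blast

lemma D2_apply_derivative: "((\<lambda>x. D2 x b v) has_derivative (\<lambda>w. D3 x w b v)) (at x)"
  using d3[of x] by (auto intro!: derivative_eq_intros simp: blinfun.zero_right)

lemma D1_apply_derivative: "((\<lambda>x. D1 x v) has_derivative (\<lambda>w. D2 x w v)) (at x)"
  using d2[of x] by (auto intro!: derivative_eq_intros simp: blinfun.zero_right)

text \<open>The third derivative is assumed to exist and be bounded, not to be continuous; the
  Taylor estimates therefore rest on the mean value inequality and not on integral
  remainders.\<close>

lemma D2_lipschitz: "\<bar>D2 x b v - D2 y b v\<bar> \<le> M * norm (x - y) * norm b * norm v"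
proof -
  have "norm (D2 x b v - D2 y b v) \<le> (M * norm b * norm v) * norm (x - y)"
  proof (rule differentiable_bound[where S=UNIV and f'="\<lambda>x w. D3 x w b v"])
    fix x
    show "onorm (\<lambda>w. D3 x w b v) \<le> M * norm b * norm v"
    proof (rule onorm_bound)
      fix w
      have "norm (D3 x w b v) \<le> frob3 (D3 x) * norm w * norm b * norm v"
        using trilinear_le_frob3[of "D3 x" w b v] by simp
      also have "\<dots> \<le> M * norm w * norm b * norm v"
        using D3_le by (intro mult_right_mono) auto
      finally show "norm (D3 x w b v) \<le> M * norm b * norm v * norm w" by (simp add: ac_simps)
    qed (simp add: M_nonneg)
  qed (use D2_apply_derivative in auto)
  then show ?thesis by (simp add: ac_simps)
qed

text \<open>Mean value inequality for \<open>D1 u v - D2 x u v\<close> as a function of u. It yields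
  M in place of M / 2, a loss that a fine enough subdivision of the ray absorbs in
  \<open>score_bias\<close>.\<close>

lemma D1_taylor: "\<bar>D1 y v - D1 x v - D2 x (y - x) v\<bar> \<le> M * (norm (y - x))\<^sup>2 * norm v"
proof -
  let ?r = "norm (y - x)"
  have "norm ((D1 y v - D2 x y v) - (D1 x v - D2 x x v)) \<le> (M * ?r * norm v) * norm (y - x)"
  proof (rule differentiable_bound[where S="cball x ?r" and f'="\<lambda>u w. D2 u w v - D2 x w v"])
    fix u assume u: "u \<in> cball x ?r"
    show "((\<lambda>u. D1 u v - D2 x u v) has_derivative (\<lambda>w. D2 u w v - D2 x w v)) (at u within cball x ?r)"
      by (rule has_derivative_at_withinI, intro has_derivative_diff D1_apply_derivative
          bounded_linear_imp_has_derivative bounded_linear_blinfun_apply2)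
    show "onorm (\<lambda>w. D2 u w v - D2 x w v) \<le> M * ?r * norm v"
    proof (rule onorm_bound)
      fix w
      have "norm (D2 u w v - D2 x w v) \<le> M * norm (u - x) * norm w * norm v"
        using D2_lipschitz[of u w v x] by simp
      also have "\<dots> \<le> M * ?r * norm w * norm v"
        using u M_nonneg by (intro mult_right_mono mult_left_mono) (auto simp: dist_norm norm_minus_commute)
      finally show "norm (D2 u w v - D2 x w v) \<le> M * ?r * norm v * norm w" by (simp add: ac_simps)
    qed (simp add: M_nonneg)
  qed (auto simp: dist_norm norm_minus_commute)
  then show ?thesis by (simp add: power2_eq_square ac_simps blinfun.diff_right blinfun.diff_left algebra_simps)
qed

lemma D2_growth: "\<bar>D2 x b v\<bar> \<le> (norm (D2 0) + M * norm x) * norm b * norm v"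
proof -
  have "\<bar>D2 0 b v\<bar> \<le> norm (D2 0 b) * norm v" using norm_blinfun[of "D2 0 b" v] by simp
  also have "\<dots> \<le> norm (D2 0) * norm b * norm v" by (intro mult_right_mono norm_blinfun) auto
  finally show ?thesis using D2_lipschitz[of x b v 0] by (simp add: distrib_right)
qed

lemma D1_growth: "\<bar>D1 x v\<bar> \<le> (norm (D1 0) + norm (D2 0) + M) * (1 + norm x)\<^sup>2 * norm v"
proof -
  have "\<bar>D1 x v\<bar> \<le> \<bar>D1 0 v\<bar> + \<bar>D2 0 x v\<bar> + M * (norm x)\<^sup>2 * norm v"
    using D1_taylor[of x v 0] by simp
  also have "\<dots> \<le> norm (D1 0) * norm v + norm (D2 0) * norm x * norm v + M * (norm x)\<^sup>2 * norm v"
    using norm_blinfun[of "D1 0" v] D2_growth[of 0 x v] by simp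
  also have "\<dots> = (norm (D1 0) * 1 + norm (D2 0) * norm x + M * (norm x)\<^sup>2) * norm v"
    by (simp add: algebra_simps)
  also have "\<dots> \<le> (norm (D1 0) * (1 + norm x)\<^sup>2 + norm (D2 0) * (1 + norm x)\<^sup>2 + M * (1 + norm x)\<^sup>2) * norm v"
    using M_nonneg by (intro mult_right_mono add_mono mult_left_mono) (auto simp: power2_eq_square algebra_simps)
  finally show ?thesis by (simp add: algebra_simps)
qed

lemma ln_p_taylor:
  "\<bar>ln (p (x + u)) - ln (p x) - D1 x u\<bar> \<le> (norm (D2 0) + M * norm x + M * norm u) * (norm u)\<^sup>2"
proof -
  let ?C = "(norm (D2 0) + M * norm x + M * norm u) * norm u"
  have "norm ((ln (p (x + u)) - D1 x (x + u)) - (ln (p x) - D1 x x)) \<le> ?C * norm (x + u - x)"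
  proof (rule differentiable_bound[where S="cball x (norm u)" and f'="\<lambda>y w. D1 y w - D1 x w"])
    fix y assume "y \<in> cball x (norm u)"
    then have y: "norm (y - x) \<le> norm u" by (simp add: dist_norm norm_minus_commute)
    show "((\<lambda>y. ln (p y) - D1 x y) has_derivative (\<lambda>w. D1 y w - D1 x w)) (at y within cball x (norm u))"
      by (rule has_derivative_at_withinI, intro has_derivative_diff d1
          bounded_linear_imp_has_derivative blinfun.bounded_linear_right)
    show "onorm (\<lambda>w. D1 y w - D1 x w) \<le> ?C"
    proof (rule onorm_bound)
      fix w
      have "norm (D1 y w - D1 x w) \<le> \<bar>D2 x (y - x) w\<bar> + M * (norm (y - x))\<^sup>2 * norm w"
        using D1_taylor[of y w x] by simp
      also have "\<dots> \<le> (norm (D2 0) + M * norm x) * norm (y - x) * norm w + M * (norm (y - x))\<^sup>2 * norm w"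
        using D2_growth by simp
      also have "\<dots> \<le> (norm (D2 0) + M * norm x) * norm u * norm w + M * (norm u)\<^sup>2 * norm w"
        using y M_nonneg by (intro add_mono mult_right_mono mult_left_mono power_mono) auto
      finally show "norm (D1 y w - D1 x w) \<le> ?C * norm w"
        by (simp add: algebra_simps power2_eq_square)
    qed (simp add: M_nonneg)
  qed (auto simp: dist_norm)
  then show ?thesis by (simp add: power2_eq_square ac_simps blinfun.add_right)
qed

text \<open>Concavity on the segment from a to b is compared with the expansion at a and divided by
  t, which leaves an error of order t.\<close>

lemma ln_p_tangent: "ln (p b) - ln (p a) \<le> D1 a (b - a)"
proof (rule le_if_le_plus_small_multiple)
  fix t :: real assume t: "0 < t" "t \<le> 1"
  let ?u = "b - a" and ?C = "norm (D2 0) + M * norm a + M * norm (b - a)"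
  have "(1 - t) * ln (p a) + t * ln (p b) \<le> ln (p (a + t *\<^sub>R ?u))"
    using concave_onD[OF logconc, of t a b] t by (simp add: algebra_simps)
  also have "\<dots> \<le> ln (p a) + t * D1 a ?u + (norm (D2 0) + M * norm a + M * norm (t *\<^sub>R ?u)) * (norm (t *\<^sub>R ?u))\<^sup>2"
    using ln_p_taylor[of a "t *\<^sub>R ?u"] by (simp add: blinfun.scaleR_right)
  also have "\<dots> \<le> ln (p a) + t * D1 a ?u + ?C * (norm (t *\<^sub>R ?u))\<^sup>2"
    using t M_nonneg by (intro add_left_mono mult_right_mono mult_left_mono) (auto intro: mult_left_le_one_le)
  finally have "t * (ln (p b) - ln (p a)) \<le> t * (D1 a ?u + (?C * (norm ?u)\<^sup>2) * t)"
    unfolding norm_scaleR power_mult_distrib using t by (simp add: algebra_simps power2_eq_square)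
  then show "ln (p b) - ln (p a) \<le> D1 a ?u + (?C * (norm ?u)\<^sup>2) * t"
    using t by (simp only: mult_le_cancel_left_pos)
qed

text \<open>The sum of the tangent inequalities at x and at y; this monotonicity makes the proximal
  map nonexpansive.\<close>

lemma D1_monotone: "D1 x (x - y) \<le> D1 y (x - y)"
  using ln_p_tangent[of x y] ln_p_tangent[of y x] by (simp add: blinfun.diff_right)

lemma p_measurable [measurable]: "p \<in> borel_measurable borel"
proof -
  have "continuous_on UNIV (\<lambda>x. exp (ln (p x)))"
    by (intro continuous_on_exp continuous_at_imp_continuous_on ballI has_derivative_continuous[OF d1])
  then show ?thesis using pos by (intro borel_measurable_continuous_onI) simp
qed

lemma nn_integral_p: "(\<integral>\<^sup>+x. p x \<partial>lborel) = 1"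
  using nn_integral_has_integral_lborel[OF p_measurable _ density] pos by (simp add: less_imp_le)

lemma D1_apply_measurable [measurable]: "(\<lambda>x. D1 x v) \<in> borel_measurable borel"
  by (intro borel_measurable_continuous_onI continuous_at_imp_continuous_on ballI
      has_derivative_continuous[OF D1_apply_derivative])

lemma p_midpoint: "p x * p y \<le> (p ((x + y) /\<^sub>R 2))\<^sup>2"
proof -
  have "(1 - 1 / 2) *\<^sub>R x + (1 / 2) *\<^sub>R y = (x + y) /\<^sub>R 2"
    by (simp only: scaleR_add_right) simp
  then have "(1 - 1 / 2) * ln (p x) + (1 / 2) * ln (p y) \<le> ln (p ((x + y) /\<^sub>R 2))"
    using concave_onD[OF logconc, of "1 / 2" x y] by simp
  then have "ln (p x * p y) \<le> ln ((p ((x + y) /\<^sub>R 2))\<^sup>2)"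
    using pos by (simp add: ln_mult ln_realpow less_imp_neq[THEN not_sym])
  then show ?thesis using pos by (simp only: ln_le_cancel_iff mult_pos_pos zero_less_power)
qed

end

section \<open>The Gaussian kernel\<close>

lemma gauss_dens_pos: "0 < \<sigma> \<Longrightarrow> 0 < gauss_dens \<sigma> u"
  by (simp add: gauss_dens_def)

lemma gauss_dens_measurable [measurable]: "gauss_dens \<sigma> \<in> borel_measurable borel"
  unfolding gauss_dens_def by measurable

text \<open>Parallelogram law: the Gaussian satisfies the strong log-concavity inequality of modulus
  1 / \<sigma>^2 with equality.\<close>

lemma gauss_dens_midpoint:
  fixes x y z :: "'a::euclidean_space"
  assumes "0 < \<sigma>"
  shows "gauss_dens \<sigma> (z - x) * gauss_dens \<sigma> (z - y) * exp (1 / \<sigma>\<^sup>2 / 4 * (norm (x - y))\<^sup>2)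
    = (gauss_dens \<sigma> (z - (x + y) /\<^sub>R 2))\<^sup>2"
proof -
  let ?m = "z - (x + y) /\<^sub>R 2" and ?c = "(2 * pi * \<sigma>\<^sup>2) powr (- real DIM('a) / 2)"
  have "(norm (z - x))\<^sup>2 + (norm (z - y))\<^sup>2 = 2 * (norm ?m)\<^sup>2 + (norm (x - y))\<^sup>2 / 2"
    unfolding power2_norm_eq_inner by (simp add: inner_simps inner_commute field_simps)
  then have "- (norm (z - x))\<^sup>2 / (2 * \<sigma>\<^sup>2) + - (norm (z - y))\<^sup>2 / (2 * \<sigma>\<^sup>2) + 1 / \<sigma>\<^sup>2 / 4 * (norm (x - y))\<^sup>2
      = 2 * (- (norm ?m)\<^sup>2 / (2 * \<sigma>\<^sup>2))"
    using assms by (simp add: field_simps)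
  then have "exp (- (norm (z - x))\<^sup>2 / (2 * \<sigma>\<^sup>2)) * exp (- (norm (z - y))\<^sup>2 / (2 * \<sigma>\<^sup>2))
      * exp (1 / \<sigma>\<^sup>2 / 4 * (norm (x - y))\<^sup>2) = (exp (- (norm ?m)\<^sup>2 / (2 * \<sigma>\<^sup>2)))\<^sup>2"
    by (simp only: exp_add[symmetric] exp_double[symmetric])
  then show ?thesis
    unfolding gauss_dens_def by (simp only: power_mult_distrib power2_eq_square ac_simps)
qed

text \<open>The exponential bound on the cubic factor is absorbed by completing the square around 3
  \<sigma>^2. Consequently functions of cubic growth are integrable against p times the kernel from
  the total mass of p alone.\<close>

lemma gauss_dens_cubic_bound:
  fixes z :: "'a::euclidean_space"
  assumes \<sigma>: "0 < \<sigma>"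
  shows "\<exists>C. \<forall>x. gauss_dens \<sigma> (z - x) * (1 + norm x) ^ 3 \<le> C"
proof (intro exI allI)
  fix x :: 'a
  let ?c = "(2 * pi * \<sigma>\<^sup>2) powr (- real DIM('a) / 2)" and ?u = "norm (z - x)"
  have "norm x \<le> norm z + ?u" by (metis norm_minus_commute norm_triangle_sub)
  also have "1 + \<dots> \<le> (1 + norm z) * (1 + ?u)" by (simp add: algebra_simps)
  also have "\<dots> \<le> (1 + norm z) * exp ?u" by (intro mult_left_mono) auto
  finally have "(1 + norm x) ^ 3 \<le> ((1 + norm z) * exp ?u) ^ 3" by (intro power_mono) auto
  also have "\<dots> = (1 + norm z) ^ 3 * exp (3 * ?u)" by (simp add: power_mult_distrib exp_of_nat_mult[symmetric])
  finally have "gauss_dens \<sigma> (z - x) * (1 + norm x) ^ 3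
      \<le> ?c * exp (- ?u\<^sup>2 / (2 * \<sigma>\<^sup>2)) * ((1 + norm z) ^ 3 * exp (3 * ?u))"
    unfolding gauss_dens_def by (intro mult_left_mono) auto
  also have "\<dots> = ?c * (1 + norm z) ^ 3 * exp (- ?u\<^sup>2 / (2 * \<sigma>\<^sup>2) + 3 * ?u)"
    by (simp only: exp_add ac_simps)
  also have "\<dots> \<le> ?c * (1 + norm z) ^ 3 * exp (9 * \<sigma>\<^sup>2 / 2)"
  proof -
    have "0 \<le> (?u - 3 * \<sigma>\<^sup>2)\<^sup>2 / (2 * \<sigma>\<^sup>2)" by simp
    also have "\<dots> = ?u\<^sup>2 / (2 * \<sigma>\<^sup>2) - 3 * ?u + 9 * \<sigma>\<^sup>2 / 2"
      using \<sigma> by (simp add: field_simps power2_eq_square)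
    finally show ?thesis by (intro mult_left_mono) auto
  qed
  finally show "gauss_dens \<sigma> (z - x) * (1 + norm x) ^ 3 \<le> ?c * (1 + norm z) ^ 3 * exp (9 * \<sigma>\<^sup>2 / 2)" .
qed

section \<open>The posterior\<close>

text \<open>The weight l = b / a is optimal, and a = 0 is the limit of large l. In this form
  Cauchy--Schwarz for a sum of expectations follows from a pointwise inequality between
  squares.\<close>

lemma le_if_le_weighted_squares:
  fixes x a b :: real
  assumes le: "\<And>l. 0 < l \<Longrightarrow> x \<le> l / 2 * a\<^sup>2 + b\<^sup>2 / (2 * l)" and a: "0 \<le> a" and b: "0 < b"
  shows "x \<le> a * b"
proof (cases "a = 0")
  case True
  have "x \<le> 0 + (b\<^sup>2 / 2) * t" if "0 < t" for t
    using le[of "1 / t"] that True by simp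
  then show ?thesis using le_if_le_plus_small_multiple[of x 0 "b\<^sup>2 / 2"] True by simp
next
  case False
  then show ?thesis using le[of "b / a"] a b by (simp add: power2_eq_square field_simps)
qed

locale posterior = smooth_log_concave_density p D1 D2 D3 M
  for p :: "'a::euclidean_space \<Rightarrow> real" and D1 D2 D3 M +
  fixes \<sigma> :: real and z :: 'a
  assumes \<sigma>: "0 < \<sigma>"
begin

definition w :: "'a \<Rightarrow> real" where
  "w x = p x * gauss_dens \<sigma> (z - x) / smoothed_density p \<sigma> z"

lemma gauss_pos: "0 < gauss_dens \<sigma> (u :: 'a)"
  by (rule gauss_dens_pos[OF \<sigma>])

lemma integrable_p_gauss_cubic:
  fixes f :: "'a \<Rightarrow> 'b::{banach, second_countable_topology}"
  assumes [measurable]: "f \<in> borel_measurable borel" and f: "\<And>x. norm (f x) \<le> K * (1 + norm x) ^ 3"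
  shows "integrable lborel (\<lambda>x. (p x * gauss_dens \<sigma> (z - x)) *\<^sub>R f x)"
proof -
  obtain C where C: "\<And>x. gauss_dens \<sigma> (z - x) * (1 + norm x) ^ 3 \<le> C"
    using gauss_dens_cubic_bound[OF \<sigma>, of z] by blast
  have K: "0 \<le> K" using f[of 0] by (auto intro: order_trans[OF norm_ge_zero])
  show ?thesis
  proof (rule Bochner_Integration.integrable_bound)
    show "integrable lborel (\<lambda>x. K * C * p x)"
      using nn_integral_p pos by (intro integrable_mult_right integrableI_nonneg) (auto simp: less_imp_le)
    show "AE x in lborel. norm ((p x * gauss_dens \<sigma> (z - x)) *\<^sub>R f x) \<le> norm (K * C * p x)"
    proof (rule AE_I2)
      fix x
      have g: "0 < gauss_dens \<sigma> (z - x)" by (rule gauss_pos)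
      have "norm ((p x * gauss_dens \<sigma> (z - x)) *\<^sub>R f x) = p x * (gauss_dens \<sigma> (z - x) * norm (f x))"
        using pos[of x] g by (simp add: abs_mult)
      also have "\<dots> \<le> p x * (gauss_dens \<sigma> (z - x) * (K * (1 + norm x) ^ 3))"
        using pos[of x] g f by (intro mult_left_mono) (auto simp: less_imp_le)
      also have "\<dots> = p x * (K * (gauss_dens \<sigma> (z - x) * (1 + norm x) ^ 3))" by simp
      also have "\<dots> \<le> p x * (K * C)"
        using pos[of x] K C by (intro mult_left_mono) (auto simp: less_imp_le)
      also have "\<dots> \<le> norm (K * C * p x)" using abs_ge_self[of "K * C * p x"] by (simp add: ac_simps)
      finally show "norm ((p x * gauss_dens \<sigma> (z - x)) *\<^sub>R f x) \<le> norm (K * C * p x)" .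
    qed
  qed measurable
qed

lemma integrable_p_gauss: "integrable lborel (\<lambda>x. p x * gauss_dens \<sigma> (z - x))"
  using integrable_p_gauss_cubic[of "\<lambda>_. 1::real" 1] by simp

lemma smoothed_density_pos: "0 < smoothed_density p \<sigma> z"
proof -
  have "0 \<le> smoothed_density p \<sigma> z"
    unfolding smoothed_density_def using pos gauss_pos
    by (intro Bochner_Integration.integral_nonneg mult_nonneg_nonneg less_imp_le)
  moreover have "smoothed_density p \<sigma> z \<noteq> 0"
  proof
    assume "smoothed_density p \<sigma> z = 0"
    then have "AE x in lborel. p x * gauss_dens \<sigma> (z - x) = 0"
      unfolding smoothed_density_def
      using integrable_p_gauss pos gauss_pos
      by (subst (asm) integral_nonneg_eq_0_iff_AE) (auto simp: less_imp_le)
    then have "AE x in (lborel :: 'a measure). False"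
      using pos gauss_pos by (simp add: less_imp_neq[THEN not_sym])
    then show False by (simp add: eventually_False ae_filter_eq_bot_iff)
  qed
  ultimately show ?thesis by simp
qed

lemma w_pos: "0 < w x"
  using pos gauss_pos smoothed_density_pos by (simp add: w_def)

lemma w_measurable' [measurable]: "w \<in> borel_measurable borel"
  unfolding w_def by measurable

lemma integral_w: "integrable lborel w" "(\<integral>x. w x \<partial>lborel) = 1"
  using integrable_p_gauss smoothed_density_pos by (simp_all add: w_def[abs_def] smoothed_density_def)

lemma nn_integral_w: "(\<integral>\<^sup>+x. w x \<partial>lborel) = 1"
  using nn_integral_eq_integral[OF integral_w(1)] integral_w(2) w_pos by (simp add: less_imp_le)

text \<open>The prior contributes its plain midpoint inequality and the Gaussian the whole gain, so
  the modulus is 1 / \<sigma>^2 for every log-concave p.\<close>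

sublocale strongly_log_concave w "1 / \<sigma>\<^sup>2"
proof (rule strongly_log_concave.intro)
  let ?Z = "smoothed_density p \<sigma> z"
  show "w x * w y * exp (1 / \<sigma>\<^sup>2 / 4 * (norm (x - y))\<^sup>2) \<le> (w ((x + y) /\<^sub>R 2))\<^sup>2" for x y
  proof -
    let ?m = "(x + y) /\<^sub>R 2"
    have "w x * w y * exp (1 / \<sigma>\<^sup>2 / 4 * (norm (x - y))\<^sup>2)
        = p x * p y * (gauss_dens \<sigma> (z - x) * gauss_dens \<sigma> (z - y) * exp (1 / \<sigma>\<^sup>2 / 4 * (norm (x - y))\<^sup>2)) / ?Z\<^sup>2"
      by (simp add: w_def power2_eq_square)
    also have "\<dots> = p x * p y * (gauss_dens \<sigma> (z - ?m))\<^sup>2 / ?Z\<^sup>2"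
      by (simp only: gauss_dens_midpoint[OF \<sigma>])
    also have "\<dots> \<le> (p ?m)\<^sup>2 * (gauss_dens \<sigma> (z - ?m))\<^sup>2 / ?Z\<^sup>2"
      by (intro divide_right_mono mult_right_mono p_midpoint) auto
    finally show ?thesis by (simp add: w_def power_mult_distrib power_divide)
  qed
  show "prob_space (density lborel (\<lambda>x. ennreal (w x)))"
    by (rule prob_spaceI) (simp add: emeasure_density nn_integral_w)
  show "0 < 1 / \<sigma>\<^sup>2" using \<sigma> by simp
  show "0 \<le> w x" for x using w_pos by (rule less_imp_le)
  have "integrable lborel (\<lambda>x. (p x * gauss_dens \<sigma> (z - x)) *\<^sub>R norm x ^ 3)"
    by (rule integrable_p_gauss_cubic[of _ 1]) (auto intro!: power_mono)
  then show "integrable (density lborel (\<lambda>x. ennreal (w x))) (\<lambda>x. norm x ^ 3)"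
    using w_pos by (subst integrable_density) (auto simp: less_imp_le w_def)
qed (rule w_measurable')

lemma integrable_id: "integrable \<mu> (\<lambda>x. x)"
  by (rule integrable_cubic_growth[of _ 1]) (auto simp: power3_eq_cube algebra_simps)

lemma mmse_eq: "mmse p \<sigma> z = expectation (\<lambda>x. x)"
proof -
  have "expectation (\<lambda>x. x) = (\<integral>x. w x *\<^sub>R x \<partial>lborel)"
    using w_pos by (subst integral_density) (auto simp: less_imp_le)
  also have "\<dots> = (\<integral>x. (p x * gauss_dens \<sigma> (z - x)) *\<^sub>R x /\<^sub>R smoothed_density p \<sigma> z \<partial>lborel)"
    by (simp add: w_def divide_inverse ac_simps)
  also have "\<dots> = mmse p \<sigma> z" unfolding mmse_def by (rule integral_scaleR_right)
  finally show ?thesis by simp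
qed

lemma integrable_inner: "integrable \<mu> (\<lambda>x. x \<bullet> v)"
  using integrable_id by simp

lemma expectation_inner: "expectation (\<lambda>x. x \<bullet> v) = mmse p \<sigma> z \<bullet> v"
  using integrable_id by (simp add: mmse_eq)

lemma integrable_D1: "integrable \<mu> (\<lambda>x. D1 x v)"
proof (rule integrable_cubic_growth)
  let ?K = "(norm (D1 0) + norm (D2 0) + M) * norm v"
  fix x
  have "norm (D1 x v) \<le> ?K * (1 + norm x)\<^sup>2" using D1_growth[of x v] by (simp add: ac_simps)
  also have "\<dots> \<le> ?K * (1 + norm x) ^ 3" using M_nonneg by (intro mult_left_mono power_increasing) auto
  finally show "norm (D1 x v) \<le> ?K * (1 + norm x) ^ 3" .
qed measurable

text \<open>Follows from 1 + \<psi> \<le> exp \<psi> for the log-ratio \<psi> of the two densities.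
  The coefficient of t^2 grows linearly in x and hence has finite expectation; t \<le> 1 frees it of
  t.\<close>

lemma w_shift_ge:
  assumes t: "0 < t" "t \<le> 1"
  shows "w x * (1 + t * (D1 x v - (x - z) \<bullet> v / \<sigma>\<^sup>2)
      - t\<^sup>2 * (((norm (D2 0) + M * norm v) + M * norm x) * (norm v)\<^sup>2 + (norm v)\<^sup>2 / (2 * \<sigma>\<^sup>2))) \<le> w (x + t *\<^sub>R v)"
proof -
  let ?u = "t *\<^sub>R v"
  define \<psi> where "\<psi> = ln (p (x + ?u)) - ln (p x) + ((norm (z - x))\<^sup>2 - (norm (z - (x + ?u)))\<^sup>2) / (2 * \<sigma>\<^sup>2)"
  have "w (x + ?u) = w x * exp \<psi>"
  proof -
    define A B where "A = exp (ln (p (x + ?u)) - ln (p x))"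
      and "B = exp (((norm (z - x))\<^sup>2 - (norm (z - (x + ?u)))\<^sup>2) / (2 * \<sigma>\<^sup>2))"
    have "p (x + ?u) = p x * A"
      using pos by (simp add: A_def exp_diff less_imp_neq[THEN not_sym])
    moreover have "gauss_dens \<sigma> (z - (x + ?u)) = gauss_dens \<sigma> (z - x) * B"
      by (simp add: B_def gauss_dens_def diff_divide_distrib flip: exp_add)
    moreover have "exp \<psi> = A * B" by (simp add: \<psi>_def A_def B_def exp_add)
    ultimately show ?thesis by (simp add: w_def)
  qed
  moreover have "(norm (D2 0) + M * norm x + M * norm ?u) * (norm ?u)\<^sup>2
      \<le> t\<^sup>2 * (((norm (D2 0) + M * norm v) + M * norm x) * (norm v)\<^sup>2)"
  proof -
    have "M * norm ?u \<le> M * norm v"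
      using t M_nonneg by (intro mult_left_mono) (auto intro: mult_left_le_one_le)
    then have "(norm (D2 0) + M * norm x + M * norm ?u) * (norm ?u)\<^sup>2
        \<le> ((norm (D2 0) + M * norm v) + M * norm x) * (norm ?u)\<^sup>2"
      by (intro mult_right_mono) auto
    then show ?thesis by (simp add: power_mult_distrib ac_simps)
  qed
  then have "t * D1 x v - t\<^sup>2 * (((norm (D2 0) + M * norm v) + M * norm x) * (norm v)\<^sup>2) \<le> ln (p (x + ?u)) - ln (p x)"
    using ln_p_taylor[of x ?u] by (simp add: blinfun.scaleR_right abs_le_iff)
  moreover have "(norm (z - x))\<^sup>2 - (norm (z - (x + ?u)))\<^sup>2 = - 2 * t * ((x - z) \<bullet> v) - t\<^sup>2 * (norm v)\<^sup>2"
    unfolding power2_norm_eq_inner by (simp add: inner_simps inner_commute power2_eq_square algebra_simps)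
  then have "((norm (z - x))\<^sup>2 - (norm (z - (x + ?u)))\<^sup>2) / (2 * \<sigma>\<^sup>2)
      = - (t * ((x - z) \<bullet> v / \<sigma>\<^sup>2)) - t\<^sup>2 * ((norm v)\<^sup>2 / (2 * \<sigma>\<^sup>2))"
    using \<sigma> by (simp add: field_simps)
  ultimately have "t * (D1 x v - (x - z) \<bullet> v / \<sigma>\<^sup>2)
      - t\<^sup>2 * (((norm (D2 0) + M * norm v) + M * norm x) * (norm v)\<^sup>2 + (norm v)\<^sup>2 / (2 * \<sigma>\<^sup>2)) \<le> \<psi>"
    by (simp add: \<psi>_def right_diff_distrib distrib_left)
  then have "1 + t * (D1 x v - (x - z) \<bullet> v / \<sigma>\<^sup>2)
      - t\<^sup>2 * (((norm (D2 0) + M * norm v) + M * norm x) * (norm v)\<^sup>2 + (norm v)\<^sup>2 / (2 * \<sigma>\<^sup>2)) \<le> exp \<psi>"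
    using exp_ge_add_one_self[of \<psi>] by linarith
  then show ?thesis using w_pos[of x] \<open>w (x + ?u) = w x * exp \<psi>\<close> by (simp add: mult_left_mono)
qed

text \<open>Integration by parts without differentiating under the integral: translation invariance of the
  Lebesgue measure together with the one-sided bound \<open>w_shift_ge\<close> for \<open>v\<close> and \<open>- v\<close>.\<close>

lemma stein_identity: "expectation (\<lambda>x. D1 x v) = (mmse p \<sigma> z - z) \<bullet> v / \<sigma>\<^sup>2"
proof -
  have half: "expectation (\<lambda>x. D1 x v) \<le> (mmse p \<sigma> z - z) \<bullet> v / \<sigma>\<^sup>2" for v
  proof -
    define \<xi> where "\<xi> x = D1 x v - (x - z) \<bullet> v / \<sigma>\<^sup>2" for x
    define \<zeta> where "\<zeta> x = ((norm (D2 0) + M * norm v) + M * norm x) * (norm v)\<^sup>2 + (norm v)\<^sup>2 / (2 * \<sigma>\<^sup>2)" for x :: 'a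
    have int: "integrable \<mu> \<xi>" "integrable \<mu> \<zeta>"
      unfolding \<xi>_def \<zeta>_def using integrable_D1[of v] integrable_inner[of v] integrable_id
      by (auto simp: inner_diff_left)
    have "expectation \<xi> \<le> 0 + expectation \<zeta> * t" if t: "0 < t" "t \<le> 1" for t
    proof -
      let ?f = "\<lambda>x. 1 + t * \<xi> x - t\<^sup>2 * \<zeta> x"
      have intf: "integrable \<mu> ?f" using int by simp
      have shift: "integrable lborel (\<lambda>x. w (x + t *\<^sub>R v))" "(\<integral>x. w (x + t *\<^sub>R v) \<partial>lborel) = 1"
      proof -
        have eq: "(lborel :: 'a measure) = distr lborel borel ((+) (t *\<^sub>R v))"
          by (simp only: lborel_distr_plus)
        have "integrable (distr lborel borel ((+) (t *\<^sub>R v))) w" using integral_w(1) by (simp only: eq[symmetric])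
        then show "integrable lborel (\<lambda>x. w (x + t *\<^sub>R v))"
          by (subst (asm) integrable_distr_eq) (auto simp: add.commute)
        have "(\<integral>x. w x \<partial>distr lborel borel ((+) (t *\<^sub>R v))) = 1" using integral_w(2) by (simp only: eq[symmetric])
        then show "(\<integral>x. w (x + t *\<^sub>R v) \<partial>lborel) = 1"
          by (subst (asm) integral_distr) (auto simp: add.commute)
      qed
      have meas: "?f \<in> borel_measurable borel" using borel_measurable_integrable[OF intf] by simp
      have "expectation ?f = (\<integral>x. w x * ?f x \<partial>lborel)"
        using w_pos meas by (subst integral_density) (auto simp: less_imp_le)
      also have "\<dots> \<le> (\<integral>x. w (x + t *\<^sub>R v) \<partial>lborel)"
      proof (rule integral_mono)
        show "integrable lborel (\<lambda>x. w x * ?f x)"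
          using intf w_pos meas by (subst (asm) integrable_density) (auto simp: less_imp_le)
        show "w x * ?f x \<le> w (x + t *\<^sub>R v)" for x
          using w_shift_ge[OF t, of x v] by (simp only: \<xi>_def \<zeta>_def)
      qed (rule shift)
      finally have "1 + t * expectation \<xi> - t\<^sup>2 * expectation \<zeta> \<le> 1"
        using int shift(2) by simp
      then have "t * expectation \<xi> \<le> t * (t * expectation \<zeta>)" by (simp add: power2_eq_square)
      then show ?thesis using t by (simp only: mult_le_cancel_left_pos) (simp add: mult.commute)
    qed
    then have "expectation \<xi> \<le> 0" by (rule le_if_le_plus_small_multiple)
    moreover have "expectation \<xi> = expectation (\<lambda>x. D1 x v) - (mmse p \<sigma> z - z) \<bullet> v / \<sigma>\<^sup>2"
      unfolding \<xi>_def using integrable_D1[of v] integrable_inner[of v]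
      by (simp add: inner_diff_left expectation_inner)
    ultimately show ?thesis by simp
  qed
  show ?thesis using half[of v] half[of "- v"] by (simp add: blinfun.minus_right)
qed

section \<open>Second moments of the posterior and the bias of its score\<close>

abbreviation m :: 'a where "m \<equiv> mmse p \<sigma> z"

lemma coord_lipschitz: "\<bar>(x - c) \<bullet> i - (y - c) \<bullet> i\<bar> \<le> norm i * norm (x - y)"
  using Cauchy_Schwarz_ineq2[of "x - y" i] by (simp add: mult.commute inner_diff_left)

lemma integrable_coord_sq: "integrable \<mu> (\<lambda>x. ((x - m) \<bullet> i)\<^sup>2)"
  unfolding power2_eq_square by (rule integrable_lipschitz_mult) (rule coord_lipschitz)+

text \<open>Poincare for all coordinate functions at once: their gradients are the basis vectors,
  whose squared entries sum to d.\<close>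

lemma sum_coord_variance: "(\<Sum>i\<in>Basis. expectation (\<lambda>x. ((x - m) \<bullet> i)\<^sup>2)) \<le> \<sigma>\<^sup>2 * DIM('a)"
proof -
  have "(\<Sum>i\<in>Basis. variance (\<lambda>x. x \<bullet> i)) \<le> real DIM('a) / (1 / \<sigma>\<^sup>2)"
  proof (rule poincare_inequality)
    show "\<bar>x \<bullet> i - y \<bullet> i\<bar> \<le> 1 * norm (x - y)" if "i \<in> Basis" for i x y :: 'a
      using coord_lipschitz[of x 0 i y] that by simp
    show "((\<lambda>x. x \<bullet> i) has_derivative (\<lambda>h. h \<bullet> i)) (at x)" for i x :: 'a
      by (auto intro!: derivative_eq_intros)
    have "(\<Sum>i\<in>Basis. \<Sum>b\<in>Basis. ((b :: 'a) \<bullet> i)\<^sup>2) = (\<Sum>i\<in>(Basis :: 'a set). 1)"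
      by (intro sum.cong refl) (simp add: inner_Basis if_distrib[of "\<lambda>x. x\<^sup>2"] cong: if_cong)
    then show "(\<Sum>i\<in>Basis. \<Sum>b\<in>Basis. ((b :: 'a) \<bullet> i)\<^sup>2) \<le> real DIM('a)" by simp
  qed simp
  then show ?thesis by (simp add: expectation_inner inner_diff_left mult.commute)
qed

lemma integrable_norm_sq: "integrable \<mu> (\<lambda>x. (norm (x - m))\<^sup>2)"
  unfolding norm_sq_eq_sum_Basis by (intro Bochner_Integration.integrable_sum integrable_coord_sq)

lemma expectation_norm_sq: "expectation (\<lambda>x. (norm (x - m))\<^sup>2) \<le> \<sigma>\<^sup>2 * DIM('a)"
  unfolding norm_sq_eq_sum_Basis using sum_coord_variance
  by (subst Bochner_Integration.integral_sum) (auto intro: integrable_coord_sq)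

lemma D2_ray_lipschitz:
  assumes "0 \<le> t"
  shows "\<bar>D2 (m + t *\<^sub>R (x - m)) i v - D2 (m + t *\<^sub>R (y - m)) i v\<bar> \<le> (M * t * norm i * norm v) * norm (x - y)"
proof -
  have "m + t *\<^sub>R (x - m) - (m + t *\<^sub>R (y - m)) = t *\<^sub>R (x - y)" by (simp add: algebra_simps)
  then show ?thesis
    using D2_lipschitz[of "m + t *\<^sub>R (x - m)" i v "m + t *\<^sub>R (y - m)"] assms by (simp add: ac_simps)
qed

lemma D2_ray_eq_sum: "D2 u (x - m) v = (\<Sum>i\<in>Basis. ((x - m) \<bullet> i) * D2 u i v)"
  by (rule linear_eq_sum_Basis) (rule bounded_linear.linear[OF bounded_linear_blinfun_apply2])

lemma integrable_D2_ray:
  assumes "0 \<le> t"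
  shows "integrable \<mu> (\<lambda>x. D2 (m + t *\<^sub>R (x - m)) (x - m) v)"
  unfolding D2_ray_eq_sum
  by (intro Bochner_Integration.integrable_sum integrable_lipschitz_mult[OF coord_lipschitz D2_ray_lipschitz[OF assms]])

text \<open>Pairing the field \<open>x \<mapsto> D2 (m + t (x - m)) \<cdot> v\<close> with \<open>x - m\<close> as a covariance, rather than bounding it
  pointwise, is what replaces the dimension by its square root.\<close>

lemma expectation_D2_ray:
  assumes t: "0 \<le> t"
  shows "expectation (\<lambda>x. D2 (m + t *\<^sub>R (x - m)) (x - m) v) \<le> t * (\<sigma>\<^sup>2 * M * sqrt DIM('a) * norm v)"
proof -
  define G where "G i x = D2 (m + t *\<^sub>R (x - m)) i v" for i x
  define c where "c i = expectation (G i)" for i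
  have G_lip: "\<bar>G i x - G i y\<bar> \<le> (M * t * norm i * norm v) * norm (x - y)" for i x y
    unfolding G_def by (rule D2_ray_lipschitz[OF t])
  \<comment> \<open>The chain rule along the ray puts t into the direction of differentiation, hence
    the bound t^2 M^2 |v|^2 on the summed squared gradients.\<close>
  have "(\<Sum>i\<in>Basis. variance (G i)) \<le> (M * t * norm v)\<^sup>2 / (1 / \<sigma>\<^sup>2)"
  proof (rule poincare_inequality)
    show "\<bar>G i x - G i y\<bar> \<le> (M * t * norm v) * norm (x - y)" if "i \<in> Basis" for i x y
      using G_lip[of i x y] that by simp
    show "(G i has_derivative (\<lambda>h. D3 (m + t *\<^sub>R (x - m)) (t *\<^sub>R h) i v)) (at x)" for i x
    proof -
      have "((\<lambda>x. m + t *\<^sub>R (x - m)) has_derivative (\<lambda>h. t *\<^sub>R h)) (at x)"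
        by (auto intro!: derivative_eq_intros)
      from has_derivative_compose[OF this D2_apply_derivative] show ?thesis by (simp only: G_def[abs_def])
    qed
    show "(\<Sum>i\<in>Basis. \<Sum>b\<in>Basis. (D3 (m + t *\<^sub>R (x - m)) (t *\<^sub>R b) i v)\<^sup>2) \<le> (M * t * norm v)\<^sup>2" for x
    proof -
      let ?T = "D3 (m + t *\<^sub>R (x - m))"
      have "(\<Sum>i\<in>Basis. \<Sum>b\<in>Basis. (?T (t *\<^sub>R b) i v)\<^sup>2) = t\<^sup>2 * (\<Sum>i\<in>Basis. \<Sum>b\<in>Basis. (?T b i v)\<^sup>2)"
        by (simp add: blinfun.scaleR_right blinfun.scaleR_left power_mult_distrib sum_distrib_left)
      also have "\<dots> \<le> t\<^sup>2 * ((frob3 ?T)\<^sup>2 * (norm v)\<^sup>2)"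
        by (intro mult_left_mono sum_trilinear_sq_le) auto
      also have "\<dots> \<le> t\<^sup>2 * (M\<^sup>2 * (norm v)\<^sup>2)"
        by (intro mult_left_mono mult_right_mono power_mono D3_le frob3_nonneg) auto
      finally show ?thesis by (simp add: power_mult_distrib ac_simps)
    qed
  qed simp
  then have varG: "(\<Sum>i\<in>Basis. expectation (\<lambda>x. (G i x - c i)\<^sup>2)) \<le> (M * t * norm v * \<sigma>)\<^sup>2"
    by (simp add: c_def power_mult_distrib)
  have lipGc: "\<bar>(G i x - c i) - (G i y - c i)\<bar> \<le> (M * t * norm i * norm v) * norm (x - y)" for i x y
    using G_lip[of i x y] by simp
  have intGc: "integrable \<mu> (\<lambda>x. (G i x - c i)\<^sup>2)" for i
    unfolding power2_eq_square by (rule integrable_lipschitz_mult) (rule lipGc)+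
  have intGcx: "integrable \<mu> (\<lambda>x. ((x - m) \<bullet> i) * (G i x - c i))" for i
    by (rule integrable_lipschitz_mult[OF coord_lipschitz lipGc])
  have intGx: "integrable \<mu> (\<lambda>x. ((x - m) \<bullet> i) * G i x)" for i
    by (rule integrable_lipschitz_mult[OF coord_lipschitz G_lip])
  \<comment> \<open>As x - m is centred, subtracting the constant \<open>c i\<close> leaves the
    expectation unchanged, and only the fluctuation of \<open>G i\<close> remains.\<close>
  have cov: "expectation (\<lambda>x. ((x - m) \<bullet> i) * G i x) = expectation (\<lambda>x. ((x - m) \<bullet> i) * (G i x - c i))" for i
  proof -
    have "expectation (\<lambda>x. (x - m) \<bullet> i) = 0"
      using integrable_inner[of i] by (simp add: inner_diff_left expectation_inner)
    moreover have "integrable \<mu> (\<lambda>x. (x - m) \<bullet> i)"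
      using integrable_inner[of i] by (simp add: inner_diff_left)
    ultimately show ?thesis using intGx[of i] by (simp add: right_diff_distrib)
  qed
  have "expectation (\<lambda>x. D2 (m + t *\<^sub>R (x - m)) (x - m) v) = (\<Sum>i\<in>Basis. expectation (\<lambda>x. ((x - m) \<bullet> i) * G i x))"
    unfolding D2_ray_eq_sum G_def[symmetric] using intGx by (subst Bochner_Integration.integral_sum) auto
  also have "\<dots> = (\<Sum>i\<in>Basis. expectation (\<lambda>x. ((x - m) \<bullet> i) * (G i x - c i)))" by (simp only: cov)
  \<comment> \<open>A single weight l serves all coordinates and is optimised after the summation,
    so the two summed variances are paired and not the d individual ones.\<close>
  also have "\<dots> \<le> (M * t * norm v * \<sigma>) * (\<sigma> * sqrt DIM('a))"
  proof (rule le_if_le_weighted_squares)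
    fix l :: real assume l: "0 < l"
    have "(\<Sum>i\<in>Basis. expectation (\<lambda>x. ((x - m) \<bullet> i) * (G i x - c i)))
        \<le> (\<Sum>i\<in>Basis. expectation (\<lambda>x. l / 2 * (G i x - c i)\<^sup>2 + 1 / (2 * l) * ((x - m) \<bullet> i)\<^sup>2))"
    proof (intro sum_mono integral_mono)
      fix i x :: 'a
      let ?a = "(x - m) \<bullet> i" and ?b = "G i x - c i"
      have "0 \<le> (l * ?b - ?a)\<^sup>2 / (2 * l)" using l by simp
      also have "\<dots> = l / 2 * ?b\<^sup>2 + 1 / (2 * l) * ?a\<^sup>2 - ?a * ?b"
        using l by (simp add: field_simps power2_eq_square)
      finally show "?a * ?b \<le> l / 2 * ?b\<^sup>2 + 1 / (2 * l) * ?a\<^sup>2" by simp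
    qed (use intGc integrable_coord_sq intGcx in auto)
    also have "\<dots> = l / 2 * (\<Sum>i\<in>Basis. expectation (\<lambda>x. (G i x - c i)\<^sup>2))
        + 1 / (2 * l) * (\<Sum>i\<in>Basis. expectation (\<lambda>x. ((x - m) \<bullet> i)\<^sup>2))"
      using intGc integrable_coord_sq by (simp add: sum.distrib sum_distrib_left)
    also have "\<dots> \<le> l / 2 * (M * t * norm v * \<sigma>)\<^sup>2 + 1 / (2 * l) * (\<sigma>\<^sup>2 * DIM('a))"
      using l by (intro add_mono mult_left_mono varG sum_coord_variance) auto
    finally show "(\<Sum>i\<in>Basis. expectation (\<lambda>x. ((x - m) \<bullet> i) * (G i x - c i)))
        \<le> l / 2 * (M * t * norm v * \<sigma>)\<^sup>2 + (\<sigma> * sqrt DIM('a))\<^sup>2 / (2 * l)"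
      by (simp add: power_mult_distrib)
  qed (use t \<sigma> M_nonneg in auto)
  finally show ?thesis by (simp add: power2_eq_square ac_simps)
qed

text \<open>A finite subdivision of the ray from m to x replaces the integral over t. The increments
  of the score telescope; each is a Hessian term, controlled in expectation by
  \<open>expectation_D2_ray\<close>, plus a quadratic remainder.\<close>

lemma score_bias: "expectation (\<lambda>x. D1 x v) - D1 m v \<le> \<sigma>\<^sup>2 * M * sqrt DIM('a) * norm v"
proof -
  let ?d = "real DIM('a)"
  \<comment> \<open>With n = 2 d the remainders sum to \<sigma>^2 M |v| / 2, at most half of the
    claim since d \<ge> 1. The sum of j / n^2 over j < n is below 1 / 2, so the Hessian terms use
    the other half.\<close>
  define N where "N = 2 * DIM('a)"
  define n where "n = real N"
  have n: "0 < n" "n = 2 * ?d" by (simp_all add: n_def N_def)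
  define X where "X j x = m + (real j / n) *\<^sub>R (x - m)" for j and x :: 'a
  let ?f = "\<lambda>j x. D2 (X j x) (x - m) v / n + M * norm v / n\<^sup>2 * (norm (x - m))\<^sup>2"
  have pw: "D1 x v - D1 m v \<le> (\<Sum>j<N. ?f j x)" for x
  proof -
    have "(\<Sum>j<N. D1 (X (Suc j) x) v - D1 (X j x) v) = D1 (X N x) v - D1 (X 0 x) v"
      by (rule sum_lessThan_telescope)
    moreover have "X N x = x" "X 0 x = m" using n by (simp_all add: X_def n_def)
    ultimately have "D1 x v - D1 m v = (\<Sum>j<N. D1 (X (Suc j) x) v - D1 (X j x) v)" by simp
    also have "\<dots> \<le> (\<Sum>j<N. ?f j x)"
    proof (rule sum_mono)
      fix j
      have "X (Suc j) x - X j x = (1 / n) *\<^sub>R (x - m)"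
        by (simp add: X_def add_divide_distrib flip: scaleR_diff_left)
      then show "D1 (X (Suc j) x) v - D1 (X j x) v \<le> ?f j x"
        using D1_taylor[of "X (Suc j) x" v "X j x"] n
        by (simp add: blinfun.scaleR_right blinfun.scaleR_left power_divide power_mult_distrib abs_le_iff ac_simps)
    qed
    finally show ?thesis .
  qed
  have int: "integrable \<mu> (\<lambda>x. D2 (X j x) (x - m) v)" for j
    unfolding X_def using n by (intro integrable_D2_ray) simp
  have "expectation (\<lambda>x. D1 x v) - D1 m v = expectation (\<lambda>x. D1 x v - D1 m v)"
    using integrable_D1[of v] by simp
  also have "\<dots> \<le> expectation (\<lambda>x. \<Sum>j<N. ?f j x)"
    using integrable_D1[of v] int integrable_norm_sq pw by (intro integral_mono) auto
  also have "\<dots> = (\<Sum>j<N. expectation (\<lambda>x. D2 (X j x) (x - m) v) / n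
      + M * norm v / n\<^sup>2 * expectation (\<lambda>x. (norm (x - m))\<^sup>2))"
    using int integrable_norm_sq by (subst Bochner_Integration.integral_sum) auto
  also have "\<dots> \<le> (\<Sum>j<N. (real j / n * (\<sigma>\<^sup>2 * M * sqrt ?d * norm v)) / n + M * norm v / n\<^sup>2 * (\<sigma>\<^sup>2 * ?d))"
  proof (intro sum_mono add_mono divide_right_mono mult_left_mono expectation_norm_sq)
    show "expectation (\<lambda>x. D2 (X j x) (x - m) v) \<le> real j / n * (\<sigma>\<^sup>2 * M * sqrt ?d * norm v)" for j
      unfolding X_def using n by (intro expectation_D2_ray) simp
  qed (use n M_nonneg in auto)
  also have "\<dots> = (\<Sum>j<N. real j) / n\<^sup>2 * (\<sigma>\<^sup>2 * M * sqrt ?d * norm v) + \<sigma>\<^sup>2 * M * norm v * (?d / n)"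
  proof -
    have collect: "(\<Sum>j<N. (real j / n * A) / n + B / n\<^sup>2 * C) = (\<Sum>j<N. real j) / n\<^sup>2 * A + B * C / n" for A B C
    proof -
      have "(\<Sum>j<N. (real j / n * A) / n + B / n\<^sup>2 * C) = (\<Sum>j<N. real j * (A / n\<^sup>2) + B * C / n\<^sup>2)"
        by (simp add: power2_eq_square)
      also have "\<dots> = (\<Sum>j<N. real j) * (A / n\<^sup>2) + n * (B * C / n\<^sup>2)"
        by (simp add: sum.distrib n_def sum_distrib_right sum_divide_distrib)
      finally show ?thesis using n by (simp add: power2_eq_square)
    qed
    show ?thesis unfolding collect by (simp add: ac_simps)
  qed
  also have "\<dots> \<le> 1 / 2 * (\<sigma>\<^sup>2 * M * sqrt ?d * norm v) + \<sigma>\<^sup>2 * M * norm v * (sqrt ?d / 2)"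
  proof (intro add_mono mult_right_mono mult_left_mono)
    have "(\<Sum>j<N. real j) = n * (n - 1) / 2"
      unfolding n_def by (induction N) (simp_all add: field_simps)
    then show "(\<Sum>j<N. real j) / n\<^sup>2 \<le> 1 / 2" using n by (simp add: field_simps power2_eq_square)
    have "1 \<le> ?d" using DIM_positive[where 'a='a] by linarith
    then show "?d / n \<le> sqrt ?d / 2" using n by simp
  qed (use M_nonneg in auto)
  finally show ?thesis by (simp add: ac_simps)
qed

end

section \<open>Convergence of the iteration\<close>

context smooth_log_concave_density
begin

text \<open>By hypothesis \<open>xs\<close> is the proximal point of \<open>zs\<close> for the step
  \<sigma>^2. Both stationarity relations are tested against v = m - xs; the score difference splits
  into the bias at m and a part that is nonpositive by monotonicity. Division by |v| gives
  nonexpansiveness up to the bias.\<close>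

lemma mmse_prox_step:
  assumes \<sigma>: "0 < \<sigma>" and zs: "\<And>v. (xs - zs) \<bullet> v = \<sigma>\<^sup>2 * D1 xs v"
  shows "norm (mmse p \<sigma> z - xs) \<le> norm (z - zs) + \<sigma> ^ 4 * M * sqrt DIM('a)"
proof -
  interpret posterior p D1 D2 D3 M \<sigma> z by unfold_locales (rule \<sigma>)
  let ?v = "m - xs"
  have "m \<bullet> ?v = z \<bullet> ?v + \<sigma>\<^sup>2 * expectation (\<lambda>x. D1 x ?v)"
    using stein_identity[of ?v] \<sigma> by (simp add: field_simps inner_diff_left)
  moreover have "xs \<bullet> ?v = zs \<bullet> ?v + \<sigma>\<^sup>2 * D1 xs ?v"
    using zs[of ?v] by (simp add: inner_diff_left)
  ultimately have "(norm ?v)\<^sup>2 = (z - zs) \<bullet> ?v + \<sigma>\<^sup>2 * (expectation (\<lambda>x. D1 x ?v) - D1 xs ?v)"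
    by (simp add: power2_norm_eq_inner inner_diff_left algebra_simps)
  also have "\<dots> \<le> norm (z - zs) * norm ?v + \<sigma>\<^sup>2 * (\<sigma>\<^sup>2 * M * sqrt DIM('a) * norm ?v)"
    using score_bias[of ?v] D1_monotone[of m xs]
    by (intro add_mono norm_cauchy_schwarz mult_left_mono) auto
  also have "\<dots> = (norm (z - zs) + \<sigma> ^ 4 * M * sqrt DIM('a)) * norm ?v"
    by (simp add: algebra_simps flip: power_add)
  finally have "norm ?v * norm ?v \<le> (norm (z - zs) + \<sigma> ^ 4 * M * sqrt DIM('a)) * norm ?v"
    by (simp add: power2_eq_square)
  then show ?thesis
    using M_nonneg by (cases "?v = 0") (auto simp: mult_le_cancel_right)
qed

text \<open>\<open>arg_min\<close> is a choice operator, so a minimiser has to be exhibited: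
  compactness provides one on a ball around y, and outside the ball the objective is at least its
  value at y.\<close>

lemma prox_neg_log_minimises:
  assumes \<tau>: "0 < \<tau>"
  shows "1 / 2 * (norm (y - prox_neg_log p \<tau> y))\<^sup>2 - \<tau> * ln (p (prox_neg_log p \<tau> y))
    \<le> 1 / 2 * (norm (y - x))\<^sup>2 - \<tau> * ln (p x)"
proof -
  let ?F = "\<lambda>x. 1 / 2 * (norm (y - x))\<^sup>2 - \<tau> * ln (p x)"
  \<comment> \<open>At this radius the quadratic u^2 / 2 overtakes the linear bound on the gain in
    \<tau> ln p that the tangent at y allows.\<close>
  define r where "r = 2 * \<tau> * norm (D1 y)"
  have r: "0 \<le> r" using \<tau> by (simp add: r_def)
  have "continuous_on (cball y r) ?F"
    by (intro continuous_intros continuous_at_imp_continuous_on ballI has_derivative_continuous[OF d1])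
  then obtain x0 where x0: "x0 \<in> cball y r" "\<And>x. x \<in> cball y r \<Longrightarrow> ?F x0 \<le> ?F x"
    using continuous_attains_inf[of "cball y r" ?F] r by auto
  have "?F x0 \<le> ?F x" for x
  proof (cases "x \<in> cball y r")
    case False
    let ?u = "norm (y - x)"
    have u: "r < ?u" using False by (simp add: dist_norm)
    have "ln (p x) - ln (p y) \<le> norm (D1 y) * ?u"
      using ln_p_tangent[of x y] norm_blinfun[of "D1 y" "x - y"] by (simp add: norm_minus_commute abs_le_iff)
    then have "\<tau> * (ln (p x) - ln (p y)) \<le> \<tau> * (norm (D1 y) * ?u)" using \<tau> by simp
    also have "\<dots> = 1 / 2 * (r * ?u)" by (simp add: r_def)
    also have "\<dots> \<le> 1 / 2 * (?u * ?u)" using u by (intro mult_left_mono mult_right_mono) auto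
    finally have "?F y \<le> ?F x" by (simp add: power2_eq_square algebra_simps)
    then show ?thesis using x0(2)[of y] r by simp
  qed (rule x0)
  then have "is_arg_min ?F (\<lambda>_. True) x0" by (simp add: is_arg_min_linorder)
  then have "is_arg_min ?F (\<lambda>_. True) (prox_neg_log p \<tau> y)"
    unfolding prox_neg_log_def arg_min_def by (rule someI)
  then show ?thesis by (simp only: is_arg_min_linorder)
qed

lemma prox_neg_log_stationary:
  assumes \<tau>: "0 < \<tau>"
  shows "(prox_neg_log p \<tau> y - y) \<bullet> v = \<tau> * D1 (prox_neg_log p \<tau> y) v"
proof -
  let ?x = "prox_neg_log p \<tau> y"
  have "((\<lambda>x. 1 / 2 * ((y - x) \<bullet> (y - x))) has_derivative (\<lambda>h. (?x - y) \<bullet> h)) (at ?x)"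
    by (auto intro!: derivative_eq_intros simp: inner_commute inner_diff_left inner_diff_right algebra_simps)
  from has_derivative_diff[OF this has_derivative_mult_right[OF d1]]
  have "((\<lambda>x. 1 / 2 * ((y - x) \<bullet> (y - x)) - \<tau> * ln (p x)) has_derivative (\<lambda>h. (?x - y) \<bullet> h - \<tau> * D1 ?x h)) (at ?x)" .
  moreover have "\<forall>\<^sub>F x in at ?x. 1 / 2 * ((y - ?x) \<bullet> (y - ?x)) - \<tau> * ln (p ?x) \<le> 1 / 2 * ((y - x) \<bullet> (y - x)) - \<tau> * ln (p x)"
    using prox_neg_log_minimises[OF \<tau>, of y] by (intro always_eventually allI) (simp only: power2_norm_eq_inner)
  ultimately have "(\<lambda>h. (?x - y) \<bullet> h - \<tau> * D1 ?x h) = (\<lambda>h. 0)" by (rule has_derivative_local_min)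
  from fun_cong[OF this, of v] show ?thesis by simp
qed

context
  fixes \<tau> :: real and y :: 'a
  assumes \<tau>: "0 < \<tau>"
begin

abbreviation xstar :: 'a where "xstar \<equiv> prox_neg_log p \<tau> y"

abbreviation denoised :: "nat \<Rightarrow> 'a" where
  "denoised k \<equiv> mmse p (sqrt (\<tau> / (real k + 1))) (prox_iter p \<tau> y k)"

text \<open>Scaling by k + 2 clears both weights and leaves coefficient 1 on y - xstar at every
  step, so the anchor term does not grow with k.\<close>

lemma prox_iter_error_Suc:
  "(real k + 2) *\<^sub>R (prox_iter p \<tau> y (Suc k) - xstar) = (real k + 1) *\<^sub>R (denoised k - xstar) + (y - xstar)"
proof -
  have "1 - (real k + 1) / (real k + 2) = 1 / (real k + 2)" by (simp add: field_simps)
  then have "prox_iter p \<tau> y (Suc k) = ((real k + 1) / (real k + 2)) *\<^sub>R denoised k + (1 / (real k + 2)) *\<^sub>R y"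
    by (simp add: Let_def)
  then have "(real k + 2) *\<^sub>R prox_iter p \<tau> y (Suc k) = (real k + 1) *\<^sub>R denoised k + y"
    by (simp add: scaleR_add_right)
  moreover have "(real k + 2) *\<^sub>R xstar = (real k + 1) *\<^sub>R xstar + xstar"
    by (simp add: scaleR_left_distrib scaleR_2)
  ultimately show ?thesis by (simp add: scaleR_diff_right del: prox_iter.simps)
qed

text \<open>\<open>xstar\<close> is the proximal point of \<open>xstar + (y - xstar) / (k + 1)\<close> for the step size \<open>\<tau> / (k + 1)\<close>, and
  the \<open>k\<close>-th iterate differs from that point by \<open>k / (k + 1)\<close> times the previous denoising error.\<close>

lemma denoised_error_step:
  "(real k + 1) * norm (denoised k - xstar)
    \<le> (real k + 1) * norm (prox_iter p \<tau> y k - (xstar + (y - xstar) /\<^sub>R (real k + 1)))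
      + \<tau>\<^sup>2 * M * sqrt DIM('a) / (real k + 1)"
proof -
  let ?n = "real k + 1" and ?s = "sqrt (\<tau> / (real k + 1))" and ?z = "prox_iter p \<tau> y k"
    and ?zs = "xstar + (y - xstar) /\<^sub>R (real k + 1)"
  have s2: "?s\<^sup>2 = \<tau> / ?n" using \<tau> by simp
  have "?s ^ 4 = (?s\<^sup>2)\<^sup>2" by (simp only: power_mult[symmetric]) simp
  also have "\<dots> = \<tau>\<^sup>2 / ?n\<^sup>2" by (simp only: s2 power_divide)
  finally have s4: "?s ^ 4 = \<tau>\<^sup>2 / ?n\<^sup>2" .
  have "norm (denoised k - xstar) \<le> norm (?z - ?zs) + ?s ^ 4 * M * sqrt DIM('a)"
  proof (rule mmse_prox_step)
    show "0 < ?s" using \<tau> by simp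
    show "(xstar - ?zs) \<bullet> v = ?s\<^sup>2 * D1 xstar v" for v
    proof -
      have "(xstar - ?zs) \<bullet> v = ((xstar - y) \<bullet> v) / ?n"
        by (simp add: inner_diff_left divide_inverse algebra_simps)
      then show ?thesis unfolding s2 prox_neg_log_stationary[OF \<tau>] by simp
    qed
  qed
  then have "?n * norm (denoised k - xstar) \<le> ?n * (norm (?z - ?zs) + ?s ^ 4 * M * sqrt DIM('a))"
    by (rule mult_left_mono) simp
  also have "\<dots> = ?n * norm (?z - ?zs) + \<tau>\<^sup>2 * M * sqrt DIM('a) / ?n"
  proof -
    have "n * (a + b / n\<^sup>2 * c * d) = n * a + b * c * d / n" if "0 < n" for n a b c d :: real
      using that by (simp add: field_simps power2_eq_square)
    then show ?thesis unfolding s4 by simp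
  qed
  finally show ?thesis .
qed

text \<open>The offset (y - xstar) / (k + 1) of the reference point cancels the anchor term of the
  recursion, so the distance from y to \<open>xstar\<close> never enters here and only the biases
  accumulate.\<close>

lemma denoised_error:
  "(real k + 1) * norm (denoised k - xstar) \<le> \<tau>\<^sup>2 * M * sqrt DIM('a) * harm (Suc k)"
proof (induction k)
  case 0
  \<comment> \<open>For k = 0 the reference point is y, which is also the initial iterate, so the
    recursion starts from the bias alone.\<close>
  show ?case using denoised_error_step[of 0] by (simp add: harm_Suc harm_expand(1))
next
  case (Suc k)
  let ?n = "real (Suc k) + 1" and ?x = "prox_iter p \<tau> y (Suc k)"
  have "?n *\<^sub>R (?x - (xstar + (y - xstar) /\<^sub>R ?n)) = ?n *\<^sub>R (?x - xstar) - (y - xstar)"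
    by (simp add: scaleR_diff_right scaleR_add_right)
  also have "\<dots> = (real k + 1) *\<^sub>R (denoised k - xstar)"
  proof -
    have "?n = real k + 2" by simp
    then show ?thesis by (simp only: prox_iter_error_Suc add_diff_cancel_right')
  qed
  finally have "norm (?n *\<^sub>R (?x - (xstar + (y - xstar) /\<^sub>R ?n))) = norm ((real k + 1) *\<^sub>R (denoised k - xstar))"
    by (rule arg_cong[where f=norm])
  then have "?n * norm (?x - (xstar + (y - xstar) /\<^sub>R ?n)) = (real k + 1) * norm (denoised k - xstar)"
    unfolding norm_scaleR by (simp del: prox_iter.simps)
  then have "?n * norm (denoised (Suc k) - xstar)
      \<le> (real k + 1) * norm (denoised k - xstar) + \<tau>\<^sup>2 * M * sqrt DIM('a) / ?n"
    using denoised_error_step[of "Suc k"] by linarith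
  also have "\<dots> \<le> \<tau>\<^sup>2 * M * sqrt DIM('a) * harm (Suc k) + \<tau>\<^sup>2 * M * sqrt DIM('a) / ?n"
    using Suc.IH by simp
  also have "\<dots> = \<tau>\<^sup>2 * M * sqrt DIM('a) * harm (Suc (Suc k))"
    by (simp add: harm_Suc[of "Suc k"] divide_inverse algebra_simps)
  finally show ?case .
qed

lemma prox_iter_error:
  assumes "1 \<le> k"
  shows "norm (prox_iter p \<tau> y k - xstar)
    \<le> (norm (y - xstar) + (ln (real k) + 1) * (\<tau>\<^sup>2 * M * sqrt DIM('a))) / (real k + 1)"
proof -
  obtain j where k: "k = Suc j" using assms by (cases k) auto
  \<comment> \<open>The sequence harm n - ln n decreases and equals 1 at n = 1.\<close>
  have harm: "harm k \<le> ln (real k) + (1 :: real)"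
    using euler_mascheroni_sequence_decreasing[of 1 k] assms by (simp add: harm_expand)
  have "(real k + 1) * norm (prox_iter p \<tau> y k - xstar) = norm ((real j + 2) *\<^sub>R (prox_iter p \<tau> y k - xstar))"
    by (simp add: k)
  also have "\<dots> \<le> (real j + 1) * norm (denoised j - xstar) + norm (y - xstar)"
    unfolding k prox_iter_error_Suc by (rule order_trans[OF norm_triangle_ineq]) simp
  also have "\<dots> \<le> \<tau>\<^sup>2 * M * sqrt DIM('a) * harm k + norm (y - xstar)"
    using denoised_error[of j] k by simp
  also have "\<dots> \<le> \<tau>\<^sup>2 * M * sqrt DIM('a) * (ln (real k) + 1) + norm (y - xstar)"
    using harm M_nonneg by (intro add_right_mono mult_left_mono) auto
  finally show ?thesis by (simp add: field_simps)
qed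

end

end

theorem theorem1:
  fixes p :: "'a::euclidean_space \<Rightarrow> real"
    and D1 :: "'a \<Rightarrow> ('a \<Rightarrow>\<^sub>L real)"
    and D2 :: "'a \<Rightarrow> ('a \<Rightarrow>\<^sub>L 'a \<Rightarrow>\<^sub>L real)"
    and D3 :: "'a \<Rightarrow> ('a \<Rightarrow>\<^sub>L 'a \<Rightarrow>\<^sub>L 'a \<Rightarrow>\<^sub>L real)"
    and \<tau> :: real and y :: 'a and M :: real
  assumes density: "(p has_integral 1) UNIV"
    and pos: "\<And>x. p x > 0"
    and logconc: "concave_on UNIV (\<lambda>x. ln (p x))"
    and d1: "\<And>x. ((\<lambda>x. ln (p x)) has_derivative blinfun_apply (D1 x)) (at x)"
    and d2: "\<And>x. (D1 has_derivative blinfun_apply (D2 x)) (at x)"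
    and d3: "\<And>x. (D2 has_derivative blinfun_apply (D3 x)) (at x)"
    and bdd: "bdd_above (range (\<lambda>x. frob3 (D3 x)))"
    and M_def: "M = (SUP x. frob3 (D3 x))"
    and tau: "\<tau> > 0"
  shows "\<forall>k::nat \<ge> 1.
           norm (prox_iter p \<tau> y k - prox_neg_log p \<tau> y)
             \<le> (ln (real k) + 7) / (real k + 1)
                 * (norm (y - prox_neg_log p \<tau> y) + \<tau>\<^sup>2 * M * sqrt (real DIM('a)))"
proof (intro allI impI)
  fix k :: nat assume k: "1 \<le> k"
  interpret smooth_log_concave_density p D1 D2 D3 M
    using assms by unfold_locales (auto intro: cSUP_upper)
  let ?E = "norm (y - prox_neg_log p \<tau> y)" and ?B = "\<tau>\<^sup>2 * M * sqrt (real DIM('a))"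
  \<comment> \<open>The bound at hand has coefficient 1 on ?E and ln k + 1 on ?B; as ln k \<ge> 0,
    both are at most ln k + 7.\<close>
  have "0 \<le> ln (real k)" using k by simp
  then have "?E + (ln (real k) + 1) * ?B \<le> (ln (real k) + 7) * ?E + (ln (real k) + 7) * ?B"
    using M_nonneg by (intro add_mono mult_right_mono) (auto simp: distrib_right)
  then have "(?E + (ln (real k) + 1) * ?B) / (real k + 1) \<le> ((ln (real k) + 7) * (?E + ?B)) / (real k + 1)"
    by (intro divide_right_mono) (auto simp: distrib_left)
  with prox_iter_error[OF tau k, of y]
  show "norm (prox_iter p \<tau> y k - prox_neg_log p \<tau> y) \<le> (ln (real k) + 7) / (real k + 1) * (?E + ?B)"
    by simp
qed

end
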